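(* Let $\rho$ be any rank-two state supported on the antisymmetric subspace of $\mathbb{C}^3\otimes\mathbb{C}^3$. Then both the Rains' bound and its regularization are strictly less than the asymptotic PPT-relative entropy of entanglement: $$R(\rho)<E_R^\infty(\rho)\qquad\text{and}\qquad R^\infty(\rho)<E_R^\infty(\rho).$$
   Context: The antisymmetric subspace of $\mathbb{C}^3\otimes\mathbb{C}^3$ is the $(-1)$-eigenspace of the swap operator. $\log=\log_2$. A state is a positive semidefinite operator of trace one. $T_B$ denotes partial transpose on the second (Bob's) system: $(|i_Aj_B\rangle\langle k_Al_B|)^{T_B}=|i_Al_B\rangle\langle k_Aj_B|$. For tensor powers, the bipartition is all of Alice's systems versus all of Bob's systems. $\|\cdot\|_1$ is the trace norm. Relative entropy: $S(\rho\|\sigma)=\mathrm{Tr}(\rho\log\rho-\rho\log\sigma)$ ($+\infty$ if $\mathrm{supp}(\rho)\not\subseteq\mathrm{supp}(\sigma)$). Rains' bound: $R(\rho)=\min\{S(\rho\|\sigma):\sigma\ge0,\ \|\sigma^{T_B}\|_1\le1\}$, with regularization $R^\infty(\rho)=\inf_{n\ge1}R(\rho^{\otimes n})/n$. PPT-relative entropy of entanglement: $E_R(\rho)=\min\{S(\rho\|\sigma):\sigma\ge0,\ \sigma^{T_B}\ge0,\ \mathrm{Tr}\,\sigma=1\}$, with asymptotic version $E_R^\infty(\rho)=\inf_{n\ge1}E_R(\rho^{\otimes n})/n$. *)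

theory Defs
  imports
    Complex_Main
    "HOL-Library.Extended_Real"
    "Jordan_Normal_Form.Schur_Decomposition"
    "Jordan_Normal_Form.DL_Rank"
begin

section \<open>Operators on finite-dimensional complex spaces\<close>

definition mtrace :: "complex mat \<Rightarrow> complex" where
  "mtrace A = (\<Sum>i<dim_row A. A $$ (i, i))"

text \<open>The order on complex numbers is the one of \<^theory>\<open>HOL-Library.Complex_Order\<close>:
  \<open>0 \<le> z\<close> says that \<open>z\<close> is real and nonnegative. Hence a positive
  semidefinite matrix is automatically Hermitian.\<close>

definition psd :: "nat \<Rightarrow> complex mat \<Rightarrow> bool" where
  "psd n A \<longleftrightarrow> A \<in> carrier_mat n n \<and> (\<forall>v \<in> carrier_vec n. 0 \<le> (A *\<^sub>v v) \<bullet>c v)"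

definition density_op :: "nat \<Rightarrow> complex mat \<Rightarrow> bool" where
  "density_op n \<rho> \<longleftrightarrow> psd n \<rho> \<and> mtrace \<rho> = 1"

definition unitary :: "nat \<Rightarrow> complex mat \<Rightarrow> bool" where
  "unitary n U \<longleftrightarrow> U \<in> carrier_mat n n \<and> mat_adjoint U * U = 1\<^sub>m n"

text \<open>For Hermitian matrices, the only ones to which it is applied, the support
  (orthogonal complement of the kernel) is the range.\<close>

definition mat_supp :: "complex mat \<Rightarrow> complex vec set" where
  "mat_supp A = {A *\<^sub>v v | v. v \<in> carrier_vec (dim_col A)}"

text \<open>Functional calculus: apply \<open>f\<close> to the eigenvalues in a spectral
  decomposition \<open>A = U diag(d) U\<^sup>\<dagger>\<close>. For Hermitian \<open>A\<close> such a decomposition exists and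
  the result does not depend on it; other matrices are never passed to this function.\<close>

definition mat_fun :: "(real \<Rightarrow> real) \<Rightarrow> complex mat \<Rightarrow> complex mat" where
  "mat_fun f A = (SOME B. \<exists>U d. unitary (dim_row A) U
     \<and> A = U * mat_diag (dim_row A) (\<lambda>i. complex_of_real (d i)) * mat_adjoint U
     \<and> B = U * mat_diag (dim_row A) (\<lambda>i. complex_of_real (f (d i))) * mat_adjoint U)"

definition trace_norm :: "complex mat \<Rightarrow> real" where
  "trace_norm X = Re (mtrace (mat_fun sqrt (mat_adjoint X * X)))"

text \<open>The real function \<open>log 2\<close> is total, with \<open>log 2 0 = 0\<close>. Thus \<open>\<rho> log \<rho>\<close>
  has eigenvalue 0 on the kernel of \<open>\<rho>\<close>, and the value assigned on the kernel of \<open>\<sigma>\<close> is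
  irrelevant when the support of \<open>\<rho>\<close> is contained in that of \<open>\<sigma>\<close>.\<close>

definition rel_entropy :: "complex mat \<Rightarrow> complex mat \<Rightarrow> ereal" where
  "rel_entropy \<rho> \<sigma> =
     (if mat_supp \<rho> \<subseteq> mat_supp \<sigma>
      then ereal (Re (mtrace (\<rho> * mat_fun (log 2) \<rho> - \<rho> * mat_fun (log 2) \<sigma>)))
      else \<infinity>)"

section \<open>Bipartite systems\<close>

text \<open>For Alice's dimension \<open>dA\<close> and Bob's dimension \<open>dB\<close>, the product basis vector
  \<open>|a\<rangle> \<otimes> |b\<rangle>\<close> has index \<open>a * dB + b\<close>; so \<open>i\<close> encodes \<open>(i div dB, i mod dB)\<close>.\<close>

definition partial_transpose :: "nat \<Rightarrow> nat \<Rightarrow> complex mat \<Rightarrow> complex mat" where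
  "partial_transpose dA dB X = mat (dA * dB) (dA * dB)
     (\<lambda>(i, j). X $$ ((i div dB) * dB + j mod dB, (j div dB) * dB + i mod dB))"

text \<open>The \<open>n\<close>-th tensor power, with the factors reordered so that Alice's \<open>n\<close> systems
  (total dimension \<open>dA ^ n\<close>) come first and Bob's \<open>n\<close> systems (\<open>dB ^ n\<close>) second. The basis state
  of the \<open>k\<close>-th copy of a local system is the \<open>k\<close>-th digit, to base \<open>dA\<close> or \<open>dB\<close>, of the
  joint local index.\<close>

definition digit :: "nat \<Rightarrow> nat \<Rightarrow> nat \<Rightarrow> nat" where
  "digit d k a = a div d ^ k mod d"

definition copy_index :: "nat \<Rightarrow> nat \<Rightarrow> nat \<Rightarrow> nat \<Rightarrow> nat \<Rightarrow> nat" where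
  "copy_index dA dB n k i = digit dA k (i div dB ^ n) * dB + digit dB k (i mod dB ^ n)"

definition tensor_power :: "nat \<Rightarrow> nat \<Rightarrow> nat \<Rightarrow> complex mat \<Rightarrow> complex mat" where
  "tensor_power dA dB n \<rho> = mat (dA ^ n * dB ^ n) (dA ^ n * dB ^ n)
     (\<lambda>(i, j). \<Prod>k<n. \<rho> $$ (copy_index dA dB n k i, copy_index dA dB n k j))"

definition swap_op :: "nat \<Rightarrow> complex mat" where
  "swap_op d = mat (d * d) (d * d)
     (\<lambda>(i, j). if i div d = j mod d \<and> i mod d = j div d then 1 else 0)"

definition antisym_space :: "nat \<Rightarrow> complex vec set" where
  "antisym_space d = {v \<in> carrier_vec (d * d). swap_op d *\<^sub>v v = - v}"

section \<open>Rains' bound and the PPT-relative entropy of entanglement\<close>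

definition rains :: "nat \<Rightarrow> nat \<Rightarrow> complex mat \<Rightarrow> ereal" where
  "rains dA dB \<rho> = (INF \<sigma> \<in> {\<sigma>. psd (dA * dB) \<sigma>
       \<and> trace_norm (partial_transpose dA dB \<sigma>) \<le> 1}. rel_entropy \<rho> \<sigma>)"

definition rains_reg :: "nat \<Rightarrow> nat \<Rightarrow> complex mat \<Rightarrow> ereal" where
  "rains_reg dA dB \<rho> =
     (INF n \<in> {1..}. rains (dA ^ n) (dB ^ n) (tensor_power dA dB n \<rho>) / ereal (real n))"

definition ppt_rel_ent :: "nat \<Rightarrow> nat \<Rightarrow> complex mat \<Rightarrow> ereal" where
  "ppt_rel_ent dA dB \<rho> = (INF \<sigma> \<in> {\<sigma>. density_op (dA * dB) \<sigma>
       \<and> psd (dA * dB) (partial_transpose dA dB \<sigma>)}. rel_entropy \<rho> \<sigma>)"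

definition ppt_rel_ent_reg :: "nat \<Rightarrow> nat \<Rightarrow> complex mat \<Rightarrow> ereal" where
  "ppt_rel_ent_reg dA dB \<rho> =
     (INF n \<in> {1..}. ppt_rel_ent (dA ^ n) (dB ^ n) (tensor_power dA dB n \<rho>) / ereal (real n))"

end

theory Submission
  imports Defs "Jordan_Normal_Form.Spectral_Radius" "Jordan_Normal_Form.DL_Rank_Submatrix"
begin

text \<open>
  Let \<open>e\<close> be the unit antisymmetric vector orthogonal to the support of \<open>\<rho>\<close>, \<open>F\<close> the swap
  and \<open>V = 1 - 2 e e\<^sup>*\<close>. The projection onto the support is \<open>P = (V - F) / 2\<close>, and
  \<open>V\<^sup>\<Gamma> \<plusminus> 2 P\<^sup>\<Gamma> \<ge> 0\<close> for the partial transposition \<open>\<Gamma>\<close>. This positivity passes to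
  tensor powers, so that every PPT state \<open>\<sigma>\<close> satisfies
  \<open>2\<^sup>n Tr (P\<^sup>n \<sigma>) \<le> Tr (V\<^sup>n \<sigma>) \<le> 1\<close> (tensor powers). Since \<open>S(\<rho>\<parallel>\<sigma>) \<ge> - log Tr (P \<sigma>)\<close> for any projection
  fixing \<open>\<rho>\<close>, the asymptotic PPT-relative entropy of entanglement is at least 1.

  On the other side, \<open>\<rho> / t\<close> is feasible in Rains' bound as soon as \<open>t\<close> bounds the trace norm of
  \<open>\<rho>\<^sup>\<Gamma>\<close>, which gives Rains' bound at most \<open>log t\<close>. The support of \<open>\<rho>\<close> has the form
  \<open>u \<and> u\<^sup>\<bottom>\<close>, and this yields \<open>t = 1 + 2 s\<close>, where \<open>s\<close> is the Frobenius norm of a positive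
  3 x 3 matrix of trace 1/2 that is not of rank one; hence \<open>s < 1/2\<close> and \<open>log t < 1\<close>. The
  regularisation is at most its first term.
\<close>


text \<open>The infimum over all \<open>n\<close> is the obstacle: a bound for one copy says nothing
  about \<open>n\<close> copies, so the lower bound has to rest on operator inequalities that
  multiply. An inequality W \<le> V alone does not survive tensoring, since a negative W has a
  positive square, but the pair -V \<le> W \<le> V does. This is used twice: after partial
  transposition for V and 2 P, and without it for -1 \<le> V \<le> 1. The detour through V matters.
  The partial transpose of P has operator norm 1 / sqrt 2, so comparing it with a multiple of the
  identity would give only 1/2 per copy. The partial transpose of V may exceed the identity, because
  only V itself is compared with 1. Rank two enters from both sides: rank below 3 supplies e, and
  rank above 1 makes the Frobenius estimate strict. For a pure antisymmetric state 1 + 2 s would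
  equal 2 and the two bounds would meet at 1.\<close>

lemma dim_mat_adjoint [simp]:
  "dim_row (mat_adjoint A) = dim_col A" "dim_col (mat_adjoint A) = dim_row A"
  by (simp_all add: mat_adjoint_def)

lemma mat_adjoint_carrier [simp]:
  "A \<in> carrier_mat m n \<Longrightarrow> mat_adjoint A \<in> carrier_mat n m"
  by (metis carrier_matD carrier_matI dim_mat_adjoint)

lemma square_mult_carrier [simp]:
  "A \<in> carrier_mat n n \<Longrightarrow> B \<in> carrier_mat n n \<Longrightarrow> A * B \<in> carrier_mat n n"
  by (rule mult_carrier_mat)

lemma index_mat_adjoint [simp]:
  fixes A :: "complex mat"
  shows "i < dim_col A \<Longrightarrow> j < dim_row A \<Longrightarrow> mat_adjoint A $$ (i, j) = cnj (A $$ (j, i))"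
  by (simp add: mat_adjoint_def mat_of_rows_def conjugate_complex_def)

lemma index_mult_mat_sum:
  assumes "i < dim_row A" "j < dim_col B" "dim_col A = dim_row B"
  shows "(A * B) $$ (i, j) = (\<Sum>k<dim_row B. A $$ (i, k) * B $$ (k, j))"
  using assms by (simp add: scalar_prod_def atLeast0LessThan)

lemma index_mult_mat_vec_sum:
  assumes "i < dim_row A" "dim_col A = dim_vec v"
  shows "(A *\<^sub>v v) $ i = (\<Sum>k<dim_vec v. A $$ (i, k) * v $ k)"
  using assms by (simp add: scalar_prod_def atLeast0LessThan)

lemma cscalar_prod_sum:
  fixes v w :: "complex vec"
  shows "v \<bullet>c w = (\<Sum>k<dim_vec w. v $ k * cnj (w $ k))"
  by (simp add: scalar_prod_def atLeast0LessThan conjugate_complex_def)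

lemma mat_adjoint_mult:
  fixes A B :: "complex mat"
  assumes "A \<in> carrier_mat m n" "B \<in> carrier_mat n p"
  shows "mat_adjoint (A * B) = mat_adjoint B * mat_adjoint A"
  by (rule eq_matI) (use assms in \<open>auto simp: index_mult_mat_sum mult.commute simp del: index_mult_mat(1)\<close>)

lemma mat_adjoint_adjoint [simp]:
  fixes A :: "complex mat"
  shows "mat_adjoint (mat_adjoint A) = A"
  by (rule eq_matI) auto

lemma mat_adjoint_diag_real:
  "mat_adjoint (mat_diag n (\<lambda>i. complex_of_real (d i))) = mat_diag n (\<lambda>i. complex_of_real (d i))"
  by (rule eq_matI) (auto simp: mat_diag_def)

section \<open>Unitary matrices and spectral decompositions in coordinates\<close>

lemma unitaryD:
  assumes "unitary n U"
  shows "U \<in> carrier_mat n n" "mat_adjoint U * U = 1\<^sub>m n" "U * mat_adjoint U = 1\<^sub>m n"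
proof -
  show U: "U \<in> carrier_mat n n" and "mat_adjoint U * U = 1\<^sub>m n"
    using assms by (auto simp: unitary_def)
  then show "U * mat_adjoint U = 1\<^sub>m n"
    by (intro mat_mult_left_right_inverse[of "mat_adjoint U" n U]) auto
qed

lemma unitary_mult:
  assumes "unitary n U" "unitary n V"
  shows "unitary n (U * V)"
proof -
  note U = unitaryD[OF assms(1)] and V = unitaryD[OF assms(2)]
  have "mat_adjoint (U * V) * (U * V) = mat_adjoint V * ((mat_adjoint U * U) * V)"
    using U(1) V(1) by (simp add: mat_adjoint_mult[of _ n n _ n] assoc_mult_mat[of _ n n _ n _ n])
  then show ?thesis
    using U V by (simp add: unitary_def)
qed

lemma spectral_entry:
  assumes U: "U \<in> carrier_mat n n" and i: "i < n" and j: "j < n"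
  shows "(U * mat_diag n d * mat_adjoint U) $$ (i, j) = (\<Sum>k<n. U $$ (i, k) * d k * cnj (U $$ (j, k)))"
  using assms by (subst index_mult_mat_sum) (auto simp: mat_diag_mult_right[of _ n])

lemma unitary_columns:
  assumes "unitary n U" "i < n" "j < n"
  shows "(\<Sum>k<n. cnj (U $$ (k, i)) * U $$ (k, j)) = (if i = j then 1 else 0)"
proof -
  note U = unitaryD[OF assms(1)]
  have "(mat_adjoint U * U) $$ (i, j) = (\<Sum>k<n. cnj (U $$ (k, i)) * U $$ (k, j))"
    using U(1) assms by (subst index_mult_mat_sum) auto
  then show ?thesis
    using U(2) assms by simp
qed

lemma unitary_rows:
  assumes "unitary n U" "i < n" "j < n"
  shows "(\<Sum>k<n. U $$ (i, k) * cnj (U $$ (j, k))) = (if i = j then 1 else 0)"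
proof -
  note U = unitaryD[OF assms(1)]
  have "(U * mat_adjoint U) $$ (i, j) = (\<Sum>k<n. U $$ (i, k) * cnj (U $$ (j, k)))"
    using U(1) assms by (subst index_mult_mat_sum) auto
  then show ?thesis
    using U(3) assms by simp
qed

subsection \<open>The spectral theorem\<close>

text \<open>The reflection along \<open>h = v - e_0\<close> exchanges \<open>e_0\<close> and
  \<open>v\<close>. Over the complex numbers this needs \<open>v $ 0\<close> to be real: then
  \<open>h\<close> has squared norm \<open>2 * (1 - v $ 0)\<close>, and \<open>c\<close> is 2
  divided by it.\<close>

lemma householder:
  fixes v :: "complex vec"
  assumes v: "v \<in> carrier_vec n" and unit: "(\<Sum>i<n. cnj (v $ i) * v $ i) = 1" and n: "0 < n"
    and real0: "v $ 0 \<in> \<real>"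
  shows "\<exists>W. unitary n W \<and> (\<forall>i<n. W $$ (i, 0) = v $ i)"
proof -
  define h where "h i = v $ i - (if i = 0 then 1 else 0)" for i
  define c where "c = 1 / (1 - v $ 0)" \<comment> \<open>\<open>= 0\<close> when \<open>v\<close> is the first basis vector\<close>
  have cr: "cnj (v $ 0) = v $ 0" "cnj c = c"
    using real0 by (auto simp: c_def Reals_cnj_iff)
  define W where "W = mat n n (\<lambda>(i, j). (if i = j then 1 else 0) - c * h i * cnj (h j))"
  have W: "W \<in> carrier_mat n n"
    by (simp add: W_def)
  have herm: "mat_adjoint W = W"
    by (rule eq_matI) (auto simp: W_def cr)
  have hh: "(\<Sum>i<n. cnj (h i) * h i) = 2 * (1 - v $ 0)"
  proof -
    have "cnj (h i) * h i = cnj (v $ i) * v $ i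
        + (if i = 0 then 1 - v $ i - cnj (v $ i) else 0)" for i
      by (auto simp: h_def algebra_simps)
    then show ?thesis
      using n unit cr by (simp add: sum.distrib)
  qed
  have c0: "c * (2 - c * (\<Sum>i<n. cnj (h i) * h i)) = 0"
    unfolding hh by (auto simp: c_def field_simps)
  have "W * W = 1\<^sub>m n"
  proof (rule eq_matI)
    fix i j assume "i < dim_row (1\<^sub>m n :: complex mat)" "j < dim_col (1\<^sub>m n :: complex mat)"
    then have ij: "i < n" "j < n" by auto
    have "(W * W) $$ (i, j) = (\<Sum>k<n. W $$ (i, k) * W $$ (k, j))"
      using ij W by (subst index_mult_mat_sum) auto
    also have "\<dots> = (\<Sum>k<n. (if i = k then (if k = j then 1 else 0) - c * h k * cnj (h j) else 0)
        - (if k = j then c * h i * cnj (h k) else 0)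
        + c * c * h i * cnj (h j) * (cnj (h k) * h k))"
      using ij by (intro sum.cong) (auto simp: W_def algebra_simps)
    also have "\<dots> = (if i = j then 1 else 0) - h i * cnj (h j) * (c * (2 - c * (\<Sum>i<n. cnj (h i) * h i)))"
      using ij by (simp add: sum.distrib sum_subtractf sum_distrib_left[symmetric] right_diff_distrib)
    finally show "(W * W) $$ (i, j) = 1\<^sub>m n $$ (i, j)"
      using ij c0 by simp
  qed (use W in auto)
  then have "unitary n W"
    using W herm by (simp add: unitary_def)
  moreover have "W $$ (i, 0) = v $ i" if i: "i < n" for i
  proof (cases "v $ 0 = 1")
    case False
    then have "c * cnj (h 0) = - 1"
      by (simp add: h_def c_def cr field_simps)
    moreover have "W $$ (i, 0) = (if i = 0 then 1 else 0) - h i * (c * cnj (h 0))"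
      using i n by (simp add: W_def)
    ultimately show ?thesis by (simp add: h_def)
  next
    \<comment> \<open>By \<open>hh\<close> the vector \<open>h\<close> vanishes here, so
      \<open>v\<close> is the first basis vector and \<open>W\<close> the identity.\<close>
    case True
    have "(\<Sum>i<n. (cmod (h i))\<^sup>2) = 0"
    proof -
      have "complex_of_real (\<Sum>i<n. (cmod (h i))\<^sup>2) = (\<Sum>i<n. cnj (h i) * h i)"
        by (simp add: complex_norm_square mult.commute del: of_real_power)
      then show ?thesis using True hh by (simp del: of_real_sum)
    qed
    then have "h i = 0"
      using i by (subst (asm) sum_nonneg_eq_0_iff) auto
    then show ?thesis
      using i n by (simp add: W_def h_def)
  qed
  ultimately show ?thesis by blast
qed

lemma unit_eigenvector_exists:
  fixes A :: "complex mat"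
  assumes A: "A \<in> carrier_mat n n" and n: "0 < n"
  shows "\<exists>v e. v \<in> carrier_vec n \<and> (\<Sum>i<n. cnj (v $ i) * v $ i) = 1 \<and> v $ 0 \<in> \<real> \<and> A *\<^sub>v v = e \<cdot>\<^sub>v v"
proof -
  obtain e where "eigenvalue A e"
    using spectrum_non_empty[OF A n] by (auto simp: spectrum_def)
  then obtain w where w: "w \<in> carrier_vec n" "w \<noteq> 0\<^sub>v n" "A *\<^sub>v w = e \<cdot>\<^sub>v w"
    using A by (auto simp: eigenvalue_def eigenvector_def)
  define r where "r = sqrt (\<Sum>i<n. (cmod (w $ i))\<^sup>2)"
  obtain i where "i < n" "w $ i \<noteq> 0"
    using w by (metis carrier_vecD eq_vecI index_zero_vec)
  then have "0 < (\<Sum>i<n. (cmod (w $ i))\<^sup>2)"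
    by (intro sum_pos2[of _ i]) auto
  then have r: "0 < r" "r\<^sup>2 = (\<Sum>i<n. (cmod (w $ i))\<^sup>2)"
    by (auto simp: r_def sum_nonneg)
  \<comment> \<open>A phase that makes the first entry real, as \<open>householder\<close>
    requires.\<close>
  define s where "s = (if w $ 0 = 0 then 1 else cnj (w $ 0) / complex_of_real (cmod (w $ 0)))"
  have s: "cnj s * s = 1"
  proof (cases "w $ 0 = 0")
    case False
    then have "w $ 0 * cnj (w $ 0) / (complex_of_real (cmod (w $ 0)))\<^sup>2 = 1"
      by (simp add: complex_norm_square[symmetric])
    then show ?thesis
      using False by (simp add: s_def power2_eq_square)
  qed (simp add: s_def)
  define v where "v = (s / complex_of_real r) \<cdot>\<^sub>v w"
  have "v $ 0 \<in> \<real>"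
  proof -
    have "s * w $ 0 = cmod (w $ 0)"
      using complex_norm_square[of "w $ 0"] by (auto simp: s_def power2_eq_square field_simps)
    then have "v $ 0 = complex_of_real (cmod (w $ 0) / r)"
      using w n by (simp add: v_def)
    then show ?thesis by simp
  qed
  moreover have "(\<Sum>i<n. cnj (v $ i) * v $ i) = 1"
  proof -
    have "(\<Sum>i<n. cnj (v $ i) * v $ i) = (\<Sum>i<n. (cnj s * s / complex_of_real (r\<^sup>2)) * complex_of_real ((cmod (w $ i))\<^sup>2))"
      using w by (intro sum.cong refl, unfold complex_norm_square) (simp add: v_def power2_eq_square)
    also have "\<dots> = 1 / complex_of_real (r\<^sup>2) * complex_of_real (\<Sum>i<n. (cmod (w $ i))\<^sup>2)"
      unfolding s by (simp add: sum_distrib_left)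
    also have "\<dots> = 1"
      using r by (simp del: of_real_sum of_real_power add: r(2)[symmetric])
    finally show ?thesis .
  qed
  moreover have "A *\<^sub>v v = e \<cdot>\<^sub>v v"
    using A w by (simp add: v_def mult_mat_vec smult_smult_assoc mult.commute)
  ultimately show ?thesis
    using w by (intro exI[of _ v] exI[of _ e]) (auto simp: v_def)
qed

lemma block_diag_mult:
  fixes A A' D D' :: "'a :: comm_semiring_1 mat"
  assumes "A \<in> carrier_mat m m" "D \<in> carrier_mat n n" "A' \<in> carrier_mat m m" "D' \<in> carrier_mat n n"
  shows "four_block_mat A (0\<^sub>m m n) (0\<^sub>m n m) D * four_block_mat A' (0\<^sub>m m n) (0\<^sub>m n m) D'
    = four_block_mat (A * A') (0\<^sub>m m n) (0\<^sub>m n m) (D * D')"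
  using assms by (subst mult_four_block_mat[of _ m m _ n _ n _ _ m _ n]) auto

text \<open>Deflation: conjugation by a unitary matrix whose first column is an eigenvector clears
  the first column below the diagonal. Hermiticity then clears the first row and makes the
  eigenvalue real, which leaves a Hermitian block of size \<open>n\<close>.\<close>

theorem hermitian_spectral:
  fixes A :: "complex mat"
  assumes "A \<in> carrier_mat n n" "mat_adjoint A = A"
  shows "\<exists>U d. unitary n U \<and> A = U * mat_diag n (\<lambda>i. complex_of_real (d i)) * mat_adjoint U"
  using assms
proof (induction n arbitrary: A)
  case 0
  show ?case
    by (rule exI[of _ "1\<^sub>m 0"], rule exI[of _ "\<lambda>_. 0"]) (use 0 in \<open>auto simp: unitary_def intro!: eq_matI\<close>)
next
  case (Suc n)
  note A = Suc.prems(1)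
  let ?N = "Suc n"
  obtain v e where v: "v \<in> carrier_vec ?N" "(\<Sum>i<?N. cnj (v $ i) * v $ i) = 1" "v $ 0 \<in> \<real>"
    and ev: "A *\<^sub>v v = e \<cdot>\<^sub>v v"
    using unit_eigenvector_exists[OF A] by blast
  obtain W where WU: "unitary ?N W" and W0: "\<And>i. i < ?N \<Longrightarrow> W $$ (i, 0) = v $ i"
    using householder[OF v(1,2) _ v(3)] by blast
  note W = unitaryD[OF WU]
  define B where "B = mat_adjoint W * A * W"
  have B: "B \<in> carrier_mat ?N ?N"
    using A W(1) by (simp add: B_def)
  have Bh: "mat_adjoint B = B"
    using A W(1) Suc.prems(2) unfolding B_def
    by (simp add: mat_adjoint_mult[of _ ?N ?N _ ?N] assoc_mult_mat[of _ ?N ?N _ ?N _ ?N])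
  have BA: "W * B * mat_adjoint W = A"
  proof -
    have "W * B * mat_adjoint W = (W * mat_adjoint W) * A * (W * mat_adjoint W)"
      using A W(1) by (simp add: B_def assoc_mult_mat[of _ ?N ?N _ ?N _ ?N])
    then show ?thesis using W A by simp
  qed
  have herm: "B $$ (j, i) = cnj (B $$ (i, j))" if "i < ?N" "j < ?N" for i j
    using that B Bh by (metis carrier_matD index_mat_adjoint)
  have col0: "B $$ (i, 0) = (if i = 0 then e else 0)" if i: "i < ?N" for i
  proof -
    have "col (A * W) 0 = A *\<^sub>v col W 0"
      using A W(1) by (intro col_mult2[of _ ?N ?N _ ?N]) auto
    also have "col W 0 = v"
      using W(1) W0 v(1) by (intro eq_vecI) auto
    finally have AW: "(A * W) $$ (k, 0) = e * v $ k" if "k < ?N" for k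
      using that A W(1) v(1) ev by (metis carrier_matD carrier_vecD index_col index_mult_mat(2,3) index_smult_vec(1) zero_less_Suc)
    have "B $$ (i, 0) = (\<Sum>k<?N. mat_adjoint W $$ (i, k) * (A * W) $$ (k, 0))"
      using A W(1) i unfolding B_def
      by (simp add: assoc_mult_mat[of _ ?N ?N _ ?N _ ?N] del: index_mult_mat(1))
        (subst index_mult_mat_sum, auto)
    also have "\<dots> = (\<Sum>k<?N. e * (cnj (W $$ (k, i)) * W $$ (k, 0)))"
      using i W(1) by (intro sum.cong) (auto simp: AW W0 simp del: index_mult_mat(1))
    also have "\<dots> = (if i = 0 then e else 0)"
      using unitary_columns[OF WU i, of 0] by (simp only: sum_distrib_left[symmetric]) auto
    finally show ?thesis .
  qed
  have ereal: "complex_of_real (Re e) = e"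
    using herm[of 0 0] col0[of 0] by (metis Reals_cnj_iff complex_is_Real_iff of_real_Re zero_less_Suc)
  define A' where "A' = mat n n (\<lambda>(i, j). B $$ (Suc i, Suc j))"
  have "mat_adjoint A' = A'"
    by (rule eq_matI) (auto simp: A'_def herm[symmetric])
  then obtain U' d' where U'u: "unitary n U'"
    and A': "A' = U' * mat_diag n (\<lambda>i. complex_of_real (d' i)) * mat_adjoint U'"
    using Suc.IH[of A'] by (auto simp: A'_def)
  note U' = unitaryD[OF U'u]
  define V where "V = four_block_mat (1\<^sub>m 1) (0\<^sub>m 1 n) (0\<^sub>m n 1) U'"
  define d where "d i = (case i of 0 \<Rightarrow> Re e | Suc i \<Rightarrow> d' i)" for i
  let ?D' = "mat_diag n (\<lambda>i. complex_of_real (d' i))"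
  have Vadj: "mat_adjoint V = four_block_mat (1\<^sub>m 1) (0\<^sub>m 1 n) (0\<^sub>m n 1) (mat_adjoint U')"
    using U'(1) by (intro eq_matI) (auto simp: V_def)
  have "mat_adjoint V * V = 1\<^sub>m ?N"
    unfolding Vadj unfolding V_def using U'
    by (simp add: block_diag_mult[of _ 1 _ n] del: One_nat_def) simp
  then have VU: "unitary ?N V"
    using U'(1) by (auto simp: unitary_def V_def)
  have D: "mat_diag ?N (\<lambda>i. complex_of_real (d i)) = four_block_mat (e \<cdot>\<^sub>m 1\<^sub>m 1) (0\<^sub>m 1 n) (0\<^sub>m n 1) ?D'"
    by (rule eq_matI) (auto simp: mat_diag_def d_def ereal split: nat.splits)
  have "V * mat_diag ?N (\<lambda>i. complex_of_real (d i)) * mat_adjoint V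
      = four_block_mat (e \<cdot>\<^sub>m 1\<^sub>m 1) (0\<^sub>m 1 n) (0\<^sub>m n 1) A'"
    unfolding Vadj D unfolding V_def using U'(1)
    by (simp add: block_diag_mult[of _ 1 _ n] A' del: One_nat_def)
  also have "\<dots> = B"
  proof (rule eq_matI)
    fix i j assume "i < dim_row B" "j < dim_col B"
    then have ij: "i < ?N" "j < ?N" using B by auto
    then show "four_block_mat (e \<cdot>\<^sub>m 1\<^sub>m 1) (0\<^sub>m 1 n) (0\<^sub>m n 1) A' $$ (i, j) = B $$ (i, j)"
      using col0[of i] col0[of j] herm[of j 0]
      by (cases i; cases j) (auto simp: A'_def)
  qed (use B in \<open>auto simp: A'_def\<close>)
  finally have "W * (V * mat_diag ?N (\<lambda>i. complex_of_real (d i)) * mat_adjoint V) * mat_adjoint W = A"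
    using BA by simp
  moreover have "W * (V * mat_diag ?N (\<lambda>i. complex_of_real (d i)) * mat_adjoint V) * mat_adjoint W
      = (W * V) * mat_diag ?N (\<lambda>i. complex_of_real (d i)) * mat_adjoint (W * V)"
    using W(1) unitaryD(1)[OF VU]
    by (simp add: mat_adjoint_mult[of _ ?N ?N _ ?N] assoc_mult_mat[of _ ?N ?N _ ?N _ ?N])
  ultimately show ?case
    using unitary_mult[OF WU VU] by metis
qed


subsection \<open>Positive semidefinite matrices\<close>

lemma psd_form_nonneg:
  assumes "psd n A"
  shows "0 \<le> (\<Sum>i<n. \<Sum>j<n. cnj (f i) * A $$ (i, j) * f j)"
proof -
  have A: "A \<in> carrier_mat n n"
    using assms by (simp add: psd_def)
  have "(A *\<^sub>v vec n f) \<bullet>c vec n f = (\<Sum>i<n. \<Sum>j<n. cnj (f i) * A $$ (i, j) * f j)"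
    using A by (auto simp: cscalar_prod_sum index_mult_mat_vec_sum sum_distrib_left sum_distrib_right
        mult_ac simp del: index_mult_mat_vec intro!: sum.cong)
  then show ?thesis
    using assms by (metis psd_def vec_carrier)
qed

lemma psdI:
  assumes A: "A \<in> carrier_mat n n"
    and "\<And>f. 0 \<le> (\<Sum>i<n. \<Sum>j<n. cnj (f i) * A $$ (i, j) * f j)"
  shows "psd n A"
proof -
  have "(A *\<^sub>v v) \<bullet>c v = (\<Sum>i<n. \<Sum>j<n. cnj (v $ i) * A $$ (i, j) * v $ j)" if "v \<in> carrier_vec n" for v
    using A that by (auto simp: cscalar_prod_sum index_mult_mat_vec_sum sum_distrib_left sum_distrib_right
        mult_ac simp del: index_mult_mat_vec intro!: sum.cong)
  then show ?thesis
    using assms by (simp add: psd_def)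
qed

lemma sum_eq_if_two:
  fixes g :: "nat \<Rightarrow> 'a :: comm_monoid_add"
  assumes "i < n" "j < n" "i \<noteq> j" "\<And>k. k \<noteq> i \<Longrightarrow> k \<noteq> j \<Longrightarrow> g k = 0"
  shows "sum g {..<n} = g i + g j"
proof -
  have "sum g {..<n} = sum g {i, j}"
    by (rule sum.mono_neutral_right) (use assms in auto)
  then show ?thesis using assms by simp
qed

lemma psd_diag:
  assumes A: "psd n A" and i: "i < n"
  shows "0 \<le> A $$ (i, i)"
proof -
  have "(\<Sum>k<n. \<Sum>l<n. cnj (if k = i then 1 else 0) * A $$ (k, l) * (if l = i then 1 else 0))
      = (\<Sum>k<n. if k = i then (\<Sum>l<n. if l = i then A $$ (k, l) else 0) else 0)"
    by (intro sum.cong refl) (simp add: if_distrib cong: if_cong)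
  then show ?thesis
    using psd_form_nonneg[OF A, of "\<lambda>k. if k = i then 1 else 0"] i by simp
qed

lemma psd_hermitian_entry:
  assumes A: "psd n A" and i: "i < n" and j: "j < n"
  shows "A $$ (j, i) = cnj (A $$ (i, j))"
proof (cases "i = j")
  case True
  then show ?thesis
    using psd_diag[OF A i] by (simp add: less_eq_complex_def complex_eq_iff)
next
  case False
  have form: "0 \<le> cnj a * A $$ (i, i) * a + cnj a * A $$ (i, j) * b
      + cnj b * A $$ (j, i) * a + cnj b * A $$ (j, j) * b" for a b
  proof -
    define f where "f k = (if k = i then a else if k = j then b else 0)" for k
    have "(\<Sum>k<n. \<Sum>l<n. cnj (f k) * A $$ (k, l) * f l)
        = (\<Sum>k<n. cnj (f k) * (A $$ (k, i) * a + A $$ (k, j) * b))"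
      using sum_eq_if_two[OF i j False, of "\<lambda>l. cnj (f k) * A $$ (k, l) * f l" for k] False
      by (simp add: f_def algebra_simps)
    also have "\<dots> = cnj a * (A $$ (i, i) * a + A $$ (i, j) * b) + cnj b * (A $$ (j, i) * a + A $$ (j, j) * b)"
      using False by (subst sum_eq_if_two[OF i j False]) (auto simp: f_def)
    also have "\<dots> = cnj a * A $$ (i, i) * a + cnj a * A $$ (i, j) * b
        + cnj b * A $$ (j, i) * a + cnj b * A $$ (j, j) * b"
      by (simp add: distrib_left mult.assoc)
    finally show ?thesis
      using psd_form_nonneg[OF A, of f] by (simp only:)
  qed
  \<comment> \<open>The vector \<open>e_i + e_j\<close> forces opposite imaginary parts, and
    \<open>e_i + \<i> e_j\<close> forces equal real parts.\<close>
  show ?thesis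
    using form[of 1 1] form[of 1 \<i>] psd_diag[OF A i] psd_diag[OF A j]
    by (auto simp: less_eq_complex_def complex_eq_iff)
qed

lemma sum_rotate:
  "(\<Sum>i\<in>A. \<Sum>j\<in>B. \<Sum>l\<in>C. g i j l) = (\<Sum>l\<in>C. \<Sum>i\<in>A. \<Sum>j\<in>B. g i j l)"
proof -
  have "(\<Sum>i\<in>A. \<Sum>j\<in>B. \<Sum>l\<in>C. g i j l) = (\<Sum>i\<in>A. \<Sum>l\<in>C. \<Sum>j\<in>B. g i j l)"
    by (intro sum.cong refl sum.swap)
  also have "\<dots> = (\<Sum>l\<in>C. \<Sum>i\<in>A. \<Sum>j\<in>B. g i j l)"
    by (rule sum.swap)
  finally show ?thesis .
qed

lemma spectral_form:
  assumes U: "unitary n U" and k: "k < n"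
  shows "(\<Sum>i<n. \<Sum>j<n. cnj (U $$ (i, k)) * (U * mat_diag n d * mat_adjoint U) $$ (i, j) * U $$ (j, k)) = d k"
proof -
  have "(\<Sum>i<n. \<Sum>j<n. cnj (U $$ (i, k)) * (U * mat_diag n d * mat_adjoint U) $$ (i, j) * U $$ (j, k))
      = (\<Sum>i<n. \<Sum>j<n. \<Sum>l<n. d l * (cnj (U $$ (i, k)) * U $$ (i, l)) * (cnj (U $$ (j, l)) * U $$ (j, k)))"
    by (intro sum.cong refl, subst spectral_entry[OF unitaryD(1)[OF U]])
      (auto simp: sum_distrib_left sum_distrib_right mult_ac)
  also have "\<dots> = (\<Sum>l<n. \<Sum>i<n. \<Sum>j<n. d l * (cnj (U $$ (i, k)) * U $$ (i, l)) * (cnj (U $$ (j, l)) * U $$ (j, k)))"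
    by (rule sum_rotate)
  also have "\<dots> = (\<Sum>l<n. d l * (\<Sum>i<n. cnj (U $$ (i, k)) * U $$ (i, l)) * (\<Sum>j<n. cnj (U $$ (j, l)) * U $$ (j, k)))"
    by (simp add: sum_product sum_distrib_left mult_ac)
  also have "\<dots> = (\<Sum>l<n. if l = k then d l else 0)"
    using k by (intro sum.cong) (auto simp: unitary_columns[OF U])
  finally show ?thesis
    using k by simp
qed

lemma psd_spectral:
  assumes A: "psd n A"
  shows "\<exists>U d. unitary n U \<and> A = U * mat_diag n (\<lambda>i. complex_of_real (d i)) * mat_adjoint U
    \<and> (\<forall>i<n. 0 \<le> d i)"
proof -
  have car: "A \<in> carrier_mat n n"
    using A by (simp add: psd_def)
  have "mat_adjoint A = A"
    by (rule eq_matI) (use car in \<open>auto simp: psd_hermitian_entry[OF A, symmetric]\<close>)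
  then obtain U d where U: "unitary n U"
    and eq: "A = U * mat_diag n (\<lambda>i. complex_of_real (d i)) * mat_adjoint U"
    using hermitian_spectral[OF car] by blast
  have "0 \<le> d k" if k: "k < n" for k
  proof -
    have "0 \<le> (\<Sum>i<n. \<Sum>j<n. cnj (U $$ (i, k)) * A $$ (i, j) * U $$ (j, k))"
      by (rule psd_form_nonneg[OF A])
    also have "\<dots> = d k"
      using spectral_form[OF U k] unfolding eq .
    finally show ?thesis
      by (simp add: less_eq_complex_def)
  qed
  then show ?thesis
    using U eq by blast
qed

text \<open>\<open>mat_fun\<close> chooses an arbitrary spectral decomposition, so independence of
  the choice is at stake. The change of basis \<open>T\<close> intertwines the two diagonal
  matrices; a nonzero entry \<open>T $$ (i, j)\<close> forces \<open>d j = e i\<close>, hence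
  \<open>T\<close> also intertwines their images under \<open>f\<close>.\<close>

lemma mat_fun_spectral:
  assumes U: "unitary n U" and A: "A = U * mat_diag n (\<lambda>i. complex_of_real (d i)) * mat_adjoint U"
  shows "mat_fun f A = U * mat_diag n (\<lambda>i. complex_of_real (f (d i))) * mat_adjoint U"
proof -
  note Uc = unitaryD[OF U]
  let ?D = "\<lambda>d. mat_diag n (\<lambda>i. complex_of_real (d i))"
  have n: "dim_row A = n"
    using A Uc by simp
  have "\<exists>B U d. unitary n U \<and> A = U * ?D d * mat_adjoint U \<and> B = U * ?D (\<lambda>i. f (d i)) * mat_adjoint U"
    using U A by blast
  then have "\<exists>U d. unitary n U \<and> A = U * ?D d * mat_adjoint U
      \<and> mat_fun f A = U * ?D (\<lambda>i. f (d i)) * mat_adjoint U"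
    unfolding mat_fun_def n by (rule someI_ex)
  then obtain V e where V: "unitary n V" and AV: "A = V * ?D e * mat_adjoint V"
    and B: "mat_fun f A = V * ?D (\<lambda>i. f (e i)) * mat_adjoint V"
    by blast
  note Vc = unitaryD[OF V]
  define T where "T = mat_adjoint V * U"
  have T: "T \<in> carrier_mat n n"
    using Uc Vc by (simp add: T_def)
  have car [simp]: "?D d \<in> carrier_mat n n" for d
    by simp
  have adj [simp]: "mat_adjoint U \<in> carrier_mat n n" "mat_adjoint V \<in> carrier_mat n n"
    using Uc Vc by simp_all
  note assoc = assoc_mult_mat[of _ n n _ n _ n]
  have "mat_adjoint V * A * U = T * ?D d * (mat_adjoint U * U)"
    unfolding A T_def using Uc(1) Vc(1) by (simp add: assoc)
  moreover have "mat_adjoint V * A * U = (mat_adjoint V * V) * ?D e * T"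
    unfolding AV T_def using Uc(1) Vc(1) by (simp add: assoc)
  ultimately have TD: "T * ?D d = ?D e * T"
    using Uc Vc T by (simp add: left_mult_one_mat[of _ n n] right_mult_one_mat[of _ n n])
  have ent: "T $$ (i, j) * d j = e i * T $$ (i, j)" if "i < n" "j < n" for i j
    using arg_cong[OF TD, of "\<lambda>M. M $$ (i, j)"] that T
    by (simp add: mat_diag_mult_left[of _ n n] mat_diag_mult_right[of _ n n])
  have "T * ?D (\<lambda>i. f (d i)) = ?D (\<lambda>i. f (e i)) * T"
  proof (rule eq_matI)
    fix i j assume "i < dim_row (?D (\<lambda>i. f (e i)) * T)" "j < dim_col (?D (\<lambda>i. f (e i)) * T)"
    then have ij: "i < n" "j < n" using T by (auto simp: mat_diag_def)
    have "T $$ (i, j) = 0 \<or> d j = e i"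
      using ent[OF ij] by (auto simp: mult.commute)
    then show "(T * ?D (\<lambda>i. f (d i))) $$ (i, j) = (?D (\<lambda>i. f (e i)) * T) $$ (i, j)"
      using ij T by (auto simp: mat_diag_mult_left[of _ n n] mat_diag_mult_right[of _ n n])
  qed (use T in \<open>auto simp: mat_diag_def\<close>)
  then have "V * (T * ?D (\<lambda>i. f (d i))) * mat_adjoint U = V * (?D (\<lambda>i. f (e i)) * T) * mat_adjoint U"
    by simp
  moreover have "V * (T * ?D (\<lambda>i. f (d i))) * mat_adjoint U
      = (V * mat_adjoint V) * (U * ?D (\<lambda>i. f (d i)) * mat_adjoint U)"
    using Uc(1) Vc(1) by (simp add: T_def assoc)
  moreover have "V * (?D (\<lambda>i. f (e i)) * T) * mat_adjoint U
      = V * ?D (\<lambda>i. f (e i)) * mat_adjoint V * (U * mat_adjoint U)"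
    using Uc(1) Vc(1) by (simp add: T_def assoc)
  ultimately show ?thesis
    using Uc Vc B by (simp add: left_mult_one_mat[of _ n n] right_mult_one_mat[of _ n n])
qed

section \<open>Trace, and a certificate for the trace norm\<close>

lemma mtrace_sum: "A \<in> carrier_mat n n \<Longrightarrow> mtrace A = (\<Sum>i<n. A $$ (i, i))"
  by (auto simp: mtrace_def)

lemma mtrace_spectral:
  assumes U: "unitary n U"
  shows "mtrace (U * mat_diag n d * mat_adjoint U) = (\<Sum>k<n. d k)"
proof -
  note Uc = unitaryD(1)[OF U]
  have "mtrace (U * mat_diag n d * mat_adjoint U) = (\<Sum>i<n. \<Sum>k<n. d k * (cnj (U $$ (i, k)) * U $$ (i, k)))"
    using Uc by (subst mtrace_sum[of _ n]) (auto simp: spectral_entry mult_ac simp del: index_mult_mat(1))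
  also have "\<dots> = (\<Sum>k<n. d k * (\<Sum>i<n. cnj (U $$ (i, k)) * U $$ (i, k)))"
    by (subst sum.swap) (simp add: sum_distrib_left)
  finally show ?thesis
    by (simp add: unitary_columns[OF U])
qed

text \<open>In the eigenbasis of \<open>X\<close> the diagonal of \<open>Z\<close> dominates
  \<open>\<bar>d k\<bar>\<close>, and the diagonal sums to the trace in every orthonormal basis.
  Bounding a trace norm thus takes a suitable \<open>Z\<close> and no knowledge of
  eigenvalues.\<close>

lemma trace_norm_le:
  assumes X: "X \<in> carrier_mat n n" "mat_adjoint X = X" and Z: "Z \<in> carrier_mat n n"
    and "psd n (Z - X)" "psd n (Z + X)"
  shows "trace_norm X \<le> Re (mtrace Z)"
proof -
  obtain U d where U: "unitary n U" and eq: "X = U * mat_diag n (\<lambda>i. complex_of_real (d i)) * mat_adjoint U"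
    using hermitian_spectral[OF X] by blast
  note Uc = unitaryD[OF U]
  have car [simp]: "mat_adjoint U \<in> carrier_mat n n"
    using Uc by simp
  have "mat_adjoint X * X = X * X"
    using X by simp
  also have "\<dots> = U * mat_diag n (\<lambda>i. complex_of_real (d i)) * (mat_adjoint U * U)
      * mat_diag n (\<lambda>i. complex_of_real (d i)) * mat_adjoint U"
    unfolding eq using Uc(1) by (simp add: assoc_mult_mat[of _ n n _ n _ n])
  also have "\<dots> = U * mat_diag n (\<lambda>i. complex_of_real ((d i)\<^sup>2)) * mat_adjoint U"
    using Uc by (simp add: right_mult_one_mat[of _ n n] assoc_mult_mat[of _ n n _ n _ n] power2_eq_square)
  finally have "mat_fun sqrt (mat_adjoint X * X) = U * mat_diag n (\<lambda>i. complex_of_real (sqrt ((d i)\<^sup>2))) * mat_adjoint U"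
    by (rule mat_fun_spectral[OF U])
  then have tn: "trace_norm X = (\<Sum>k<n. \<bar>d k\<bar>)"
    using U by (simp add: trace_norm_def mtrace_spectral)
  have form: "(\<Sum>i<n. \<Sum>j<n. cnj (U $$ (i, k)) * X $$ (i, j) * U $$ (j, k)) = d k" if k: "k < n" for k
    using spectral_form[OF U k] unfolding eq .
  define z where "z k = (\<Sum>i<n. \<Sum>j<n. cnj (U $$ (i, k)) * Z $$ (i, j) * U $$ (j, k))" for k
  have "\<bar>d k\<bar> \<le> Re (z k)" if k: "k < n" for k
  proof -
    have "0 \<le> z k - d k"
      using psd_form_nonneg[OF assms(4), of "\<lambda>i. U $$ (i, k)"] X Z form[OF k]
      by (simp add: z_def algebra_simps sum_subtractf)
    moreover have "0 \<le> z k + d k"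
      using psd_form_nonneg[OF assms(5), of "\<lambda>i. U $$ (i, k)"] X Z form[OF k]
      by (simp add: z_def algebra_simps sum.distrib)
    ultimately show ?thesis
      by (auto simp: less_eq_complex_def abs_le_iff)
  qed
  then have "trace_norm X \<le> Re (\<Sum>k<n. z k)"
    unfolding tn by (auto intro: sum_mono)
  also have "(\<Sum>k<n. z k) = (\<Sum>i<n. \<Sum>j<n. \<Sum>k<n. cnj (U $$ (i, k)) * Z $$ (i, j) * U $$ (j, k))"
    unfolding z_def by (rule sum_rotate[symmetric])
  also have "\<dots> = (\<Sum>i<n. \<Sum>j<n. Z $$ (i, j) * (\<Sum>k<n. U $$ (j, k) * cnj (U $$ (i, k))))"
    by (simp add: sum_distrib_left mult_ac)
  also have "\<dots> = (\<Sum>i<n. \<Sum>j<n. if j = i then Z $$ (i, j) else 0)"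
    by (intro sum.cong) (auto simp: unitary_rows[OF U])
  also have "\<dots> = mtrace Z"
    using Z by (simp add: mtrace_sum[of _ n])
  finally show ?thesis .
qed


subsection \<open>Positive kernels\<close>

text \<open>Finite sums of rank-one kernels. Working with kernels on arbitrary index types makes
  Schur's product theorem an induction and lets a tensor power be treated as an entrywise
  product of pullbacks, without rearranging Kronecker products.\<close>

inductive pos_kernel :: "('i \<Rightarrow> 'i \<Rightarrow> complex) \<Rightarrow> bool" where
  rank_one: "pos_kernel (\<lambda>i j. g i * cnj (g j))"
| add: "pos_kernel K \<Longrightarrow> pos_kernel L \<Longrightarrow> pos_kernel (\<lambda>i j. K i j + L i j)"

lemma pos_kernel_zero: "pos_kernel (\<lambda>i j. 0)"
  using pos_kernel.rank_one[of "\<lambda>_. 0"] by simp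

lemma pos_kernel_scale:
  assumes "pos_kernel K" "0 \<le> c"
  shows "pos_kernel (\<lambda>i j. complex_of_real c * K i j)"
  using assms(1)
proof induction
  case (rank_one g)
  have "complex_of_real c = complex_of_real (sqrt c) * complex_of_real (sqrt c)"
    using assms(2) by (simp flip: of_real_mult)
  then show ?case
    using pos_kernel.rank_one[of "\<lambda>i. complex_of_real (sqrt c) * g i"] by (simp add: mult_ac)
next
  case (add K L)
  then show ?case
    using pos_kernel.add by (fastforce simp: distrib_left)
qed

lemma pos_kernel_sum:
  assumes "\<And>m. m \<in> M \<Longrightarrow> pos_kernel (K m)"
  shows "pos_kernel (\<lambda>i j. \<Sum>m\<in>M. K m i j)"
  using assms
  by (induction M rule: infinite_finite_induct) (auto intro: pos_kernel_zero pos_kernel.add)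

lemma pos_kernel_cnj: "pos_kernel K \<Longrightarrow> pos_kernel (\<lambda>i j. cnj (K i j))"
proof (induction rule: pos_kernel.induct)
  case (rank_one g)
  then show ?case
    using pos_kernel.rank_one[of "\<lambda>i. cnj (g i)"] by simp
next
  case (add K L)
  then show ?case
    using pos_kernel.add by fastforce
qed

lemma pos_kernel_comp: "pos_kernel K \<Longrightarrow> pos_kernel (\<lambda>i j. K (f i) (f j))"
proof (induction rule: pos_kernel.induct)
  case (rank_one g)
  show ?case
    by (rule pos_kernel.rank_one[of "\<lambda>i. g (f i)"])
next
  case (add K L)
  then show ?case
    using pos_kernel.add by fastforce
qed

lemma pos_kernel_mult:
  assumes "pos_kernel K" "pos_kernel L"
  shows "pos_kernel (\<lambda>i j. K i j * L i j)"
  using assms(1)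
proof induction
  case (rank_one g)
  show ?case
    using assms(2)
  proof induction
    case (rank_one h)
    then show ?case
      using pos_kernel.rank_one[of "\<lambda>i. g i * h i"] by (simp add: mult_ac)
  next
    case (add K L)
    then show ?case
      using pos_kernel.add by (fastforce simp: distrib_left)
  qed
next
  case (add K L)
  then show ?case
    using pos_kernel.add by (fastforce simp: distrib_right)
qed

text \<open>Against a rank-one kernel the trace is the quadratic form of \<open>A\<close> at
  \<open>g\<close>. This converts kernel inequalities into inequalities between
  expectations.\<close>

lemma pos_kernel_trace_nonneg:
  assumes "pos_kernel K" "psd n A"
  shows "0 \<le> (\<Sum>i<n. \<Sum>j<n. K i j * A $$ (j, i))"
  using assms(1)
proof induction
  case (rank_one g)
  have "(\<Sum>i<n. \<Sum>j<n. g i * cnj (g j) * A $$ (j, i)) = (\<Sum>j<n. \<Sum>i<n. cnj (g j) * A $$ (j, i) * g i)"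
    by (subst sum.swap) (simp add: mult_ac)
  then show ?case
    using psd_form_nonneg[OF assms(2)] by simp
next
  case (add K L)
  then show ?case
    by (simp add: distrib_right sum.distrib)
qed

lemma mult_cnj_nonneg: "0 \<le> z * cnj z"
  by (simp add: complex_norm_square[symmetric] less_eq_complex_def del: of_real_power)

lemma pos_kernel_form_nonneg:
  assumes "pos_kernel K"
  shows "0 \<le> (\<Sum>i<n. \<Sum>j<n. cnj (f i) * K i j * f j)"
  using assms
proof induction
  case (rank_one g)
  have "(\<Sum>i<n. \<Sum>j<n. cnj (f i) * (g i * cnj (g j)) * f j)
      = (\<Sum>i<n. cnj (f i) * g i) * (\<Sum>j<n. f j * cnj (g j))"
    by (simp only: sum_product) (simp add: mult_ac)
  also have "\<dots> = (\<Sum>i<n. cnj (f i) * g i) * cnj (\<Sum>i<n. cnj (f i) * g i)"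
    by simp
  finally have "(\<Sum>i<n. \<Sum>j<n. cnj (f i) * (g i * cnj (g j)) * f j)
      = (\<Sum>i<n. cnj (f i) * g i) * cnj (\<Sum>i<n. cnj (f i) * g i)" .
  then show ?case
    by (simp only: mult_cnj_nonneg)
next
  case (add K L)
  then show ?case
    by (simp add: distrib_right distrib_left sum.distrib)
qed

lemma psd_of_pos_kernel:
  assumes "A \<in> carrier_mat n n" "pos_kernel K" "\<And>i j. i < n \<Longrightarrow> j < n \<Longrightarrow> A $$ (i, j) = K i j"
  shows "psd n A"
proof (rule psdI)
  fix f :: "nat \<Rightarrow> complex"
  show "0 \<le> (\<Sum>i<n. \<Sum>j<n. cnj (f i) * A $$ (i, j) * f j)"
    using pos_kernel_form_nonneg[OF assms(2), where n = n and f = f] by (simp add: assms(3))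
qed (fact assms(1))

text \<open>Kernels live on all natural numbers, while a matrix constrains only indices below
  \<open>n\<close>; hence agreement is asserted on that range only.\<close>

lemma pos_kernel_of_psd:
  assumes "psd n A"
  obtains K where "pos_kernel K" "\<And>i j. i < n \<Longrightarrow> j < n \<Longrightarrow> A $$ (i, j) = K i j"
proof -
  obtain U d where U: "unitary n U"
    and eq: "A = U * mat_diag n (\<lambda>i. complex_of_real (d i)) * mat_adjoint U" and d: "\<And>i. i < n \<Longrightarrow> 0 \<le> d i"
    using psd_spectral[OF assms] by blast
  have "pos_kernel (\<lambda>i j. \<Sum>k<n. complex_of_real (d k) * (U $$ (i, k) * cnj (U $$ (j, k))))"
    using d by (intro pos_kernel_sum pos_kernel_scale pos_kernel.rank_one) auto
  then show ?thesis
    using spectral_entry[OF unitaryD(1)[OF U], of _ _ "\<lambda>i. complex_of_real (d i)"]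
    by (intro that) (auto simp: eq mult_ac)
qed

lemma pos_kernel_prod:
  fixes n :: nat
  assumes "\<And>k. k < n \<Longrightarrow> pos_kernel (K k)"
  shows "pos_kernel (\<lambda>i j. \<Prod>k<n. K k i j)"
  using assms
proof (induction n)
  case 0
  then show ?case
    using pos_kernel.rank_one[of "\<lambda>_. 1"] by simp
next
  case (Suc n)
  then show ?case
    by (simp add: pos_kernel_mult)
qed

text \<open>The induction carries both signs at once, by
  \<open>2 * (P * V - Q * W) = (P + Q) * (V - W) + (P - Q) * (V + W)\<close> and its analogue for
  the sum. With factors pulled back from the single copies, the entrywise product is a tensor
  product.\<close>

lemma pos_kernel_prod_diff_add:
  fixes n :: nat
  assumes "\<And>k. k < n \<Longrightarrow> pos_kernel (\<lambda>i j. V k i j - W k i j)"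
    and "\<And>k. k < n \<Longrightarrow> pos_kernel (\<lambda>i j. V k i j + W k i j)"
  shows "pos_kernel (\<lambda>i j. (\<Prod>k<n. V k i j) - (\<Prod>k<n. W k i j))
    \<and> pos_kernel (\<lambda>i j. (\<Prod>k<n. V k i j) + (\<Prod>k<n. W k i j))"
  using assms
proof (induction n)
  case 0
  then show ?case
    using pos_kernel_zero pos_kernel_scale[OF pos_kernel.rank_one[of "\<lambda>_. 1"], of 2] by simp
next
  case (Suc n)
  let ?P = "\<lambda>i j. \<Prod>k<n. V k i j" and ?Q = "\<lambda>i j. \<Prod>k<n. W k i j"
  let ?h = "complex_of_real (1 / 2)"
  have IH: "pos_kernel (\<lambda>i j. ?P i j - ?Q i j)" "pos_kernel (\<lambda>i j. ?P i j + ?Q i j)"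
    using Suc by auto
  have VW: "pos_kernel (\<lambda>i j. V n i j - W n i j)" "pos_kernel (\<lambda>i j. V n i j + W n i j)"
    using Suc.prems by auto
  have "pos_kernel (\<lambda>i j. ?h * ((?P i j + ?Q i j) * (V n i j - W n i j) + (?P i j - ?Q i j) * (V n i j + W n i j)))"
    by (intro pos_kernel_scale pos_kernel.add pos_kernel_mult IH VW) simp
  moreover have "pos_kernel (\<lambda>i j. ?h * ((?P i j + ?Q i j) * (V n i j + W n i j) + (?P i j - ?Q i j) * (V n i j - W n i j)))"
    by (intro pos_kernel_scale pos_kernel.add pos_kernel_mult IH VW) simp
  ultimately show ?case
    by (simp add: algebra_simps)
qed

subsection \<open>Index arithmetic of tensor powers\<close>

lemma digit_less: "0 < d \<Longrightarrow> digit d k a < d"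
  by (simp add: digit_def)

lemma digits_inject:
  assumes "a < d ^ n" "b < d ^ n" "\<And>k. k < n \<Longrightarrow> digit d k a = digit d k b"
  shows "a = b"
  using assms
proof (induction n arbitrary: a b)
  case (Suc n)
  have "a div d = b div d"
  proof (rule Suc.IH)
    show "a div d < d ^ n" "b div d < d ^ n"
      using Suc.prems(1,2) by (simp_all add: less_mult_imp_div_less mult.commute)
    show "digit d k (a div d) = digit d k (b div d)" if "k < n" for k
      using Suc.prems(3)[of "Suc k"] that by (simp add: digit_def div_mult2_eq)
  qed
  moreover have "a mod d = b mod d"
    using Suc.prems(3)[of 0] by (simp add: digit_def)
  ultimately show ?case
    by (metis div_mult_mod_eq)
qed simp

lemma copy_index_less:
  assumes "0 < dA" "0 < dB"
  shows "copy_index dA dB n k i < dA * dB"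
proof -
  have "digit dA k (i div dB ^ n) * dB + digit dB k (i mod dB ^ n) < (digit dA k (i div dB ^ n) + 1) * dB"
    using digit_less[OF assms(2)] by simp
  also have "\<dots> \<le> dA * dB"
    using digit_less[OF assms(1)] by (intro mult_right_mono) (simp_all add: Suc_leI)
  finally show ?thesis
    by (simp add: copy_index_def)
qed

lemma copy_index_div_mod:
  assumes "0 < dB"
  shows "copy_index dA dB n k i div dB = digit dA k (i div dB ^ n)"
    "copy_index dA dB n k i mod dB = digit dB k (i mod dB ^ n)"
  using digit_less[OF assms] by (simp_all add: copy_index_def assms)

lemma copy_index_inject:
  assumes "0 < dB" "i < dA ^ n * dB ^ n" "j < dA ^ n * dB ^ n"
    and "\<And>k. k < n \<Longrightarrow> copy_index dA dB n k i = copy_index dA dB n k j"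
  shows "i = j"
proof -
  have "i div dB ^ n = j div dB ^ n"
  proof (rule digits_inject[of _ dA n])
    show "digit dA k (i div dB ^ n) = digit dA k (j div dB ^ n)" if "k < n" for k
      using assms(4)[OF that] copy_index_div_mod(1)[OF assms(1), of dA n k] by metis
  qed (use assms in \<open>auto intro: less_mult_imp_div_less\<close>)
  moreover have "i mod dB ^ n = j mod dB ^ n"
  proof (rule digits_inject[of _ dB n])
    show "digit dB k (i mod dB ^ n) = digit dB k (j mod dB ^ n)" if "k < n" for k
      using assms(4)[OF that] copy_index_div_mod(2)[OF assms(1), of dA n k] by metis
  qed (use assms in auto)
  ultimately show ?thesis
    by (metis div_mult_mod_eq)
qed

text \<open>Sending a joint index to its \<open>n\<close> copy indices is a bijection onto all
  \<open>n\<close>-tuples, injective by digit expansion and surjective by counting. What remains is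
  the distributive law.\<close>

lemma sum_prod_copy_index:
  fixes f :: "nat \<Rightarrow> nat \<Rightarrow> 'a :: comm_semiring_1"
  assumes "0 < dA" "0 < dB"
  shows "(\<Sum>i<dA ^ n * dB ^ n. \<Prod>k<n. f k (copy_index dA dB n k i)) = (\<Prod>k<n. \<Sum>x<dA * dB. f k x)"
proof -
  let ?N = "dA ^ n * dB ^ n" and ?c = "\<lambda>i. \<lambda>k\<in>{..<n}. copy_index dA dB n k i"
  let ?P = "PiE {..<n} (\<lambda>_. {..<dA * dB})"
  have inj: "inj_on ?c {..<?N}"
  proof (rule inj_onI)
    fix i j assume ij: "i \<in> {..<?N}" "j \<in> {..<?N}" and eq: "?c i = ?c j"
    show "i = j"
    proof (rule copy_index_inject[OF assms(2)])
      show "copy_index dA dB n k i = copy_index dA dB n k j" if "k < n" for k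
        using fun_cong[OF eq, of k] that by simp
    qed (use ij in auto)
  qed
  have "?c ` {..<?N} = ?P"
  proof (rule card_subset_eq)
    show "?c ` {..<?N} \<subseteq> ?P"
      by (auto simp: PiE_def copy_index_less[OF assms])
    have "card (?c ` {..<?N}) = ?N"
      using card_image[OF inj] by simp
    also have "\<dots> = card ?P"
      by (simp add: card_PiE power_mult_distrib)
    finally show "card (?c ` {..<?N}) = card ?P" .
    show "finite ?P"
      by (intro finite_PiE) auto
  qed
  then have "(\<Sum>g\<in>?P. \<Prod>k<n. f k (g k)) = (\<Sum>i<?N. \<Prod>k<n. f k (?c i k))"
    using sum.reindex[OF inj, of "\<lambda>g. \<Prod>k<n. f k (g k)"] by simp
  also have "\<dots> = (\<Sum>i<?N. \<Prod>k<n. f k (copy_index dA dB n k i))"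
    by simp
  finally show ?thesis
    by (simp add: prod_sum_PiE)
qed

lemma mixed_index_less:
  fixes i j :: nat
  assumes "i < a * d" "0 < d"
  shows "(i div d) * d + j mod d < a * d"
proof -
  have "(i div d) * d + j mod d < (i div d + 1) * d"
    using assms(2) by simp
  also have "\<dots> \<le> a * d"
    using assms by (intro mult_right_mono) (auto simp: Suc_leI less_mult_imp_div_less)
  finally show ?thesis .
qed

text \<open>Exchanging Bob's parts of two indices is an involution on pairs of indices.\<close>

lemma sum_mixed_index:
  fixes f :: "nat \<Rightarrow> nat \<Rightarrow> 'a :: comm_monoid_add"
  assumes "0 < d"
  shows "(\<Sum>i<a * d. \<Sum>j<a * d. f ((i div d) * d + j mod d) ((j div d) * d + i mod d)) = (\<Sum>i<a * d. \<Sum>j<a * d. f i j)"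
  unfolding sum.cartesian_product
  using assms
  by (intro sum.reindex_bij_witness[where i = "\<lambda>(i, j). ((i div d) * d + j mod d, (j div d) * d + i mod d)"
        and j = "\<lambda>(i, j). ((i div d) * d + j mod d, (j div d) * d + i mod d)"])
    (auto intro!: mixed_index_less)

text \<open>Exchanging Bob's parts commutes with the extraction of a copy; this is why the partial
  transpose of a tensor power can be taken copy by copy.\<close>

lemma copy_index_mixed:
  assumes "0 < dB"
  shows "copy_index dA dB n k ((i div dB ^ n) * dB ^ n + j mod dB ^ n)
    = (copy_index dA dB n k i div dB) * dB + copy_index dA dB n k j mod dB"
  using assms by (simp add: copy_index_div_mod) (simp add: copy_index_def)


subsection \<open>Tensor powers\<close>

lemma tensor_power_carrier [simp]:
  "tensor_power dA dB n A \<in> carrier_mat (dA ^ n * dB ^ n) (dA ^ n * dB ^ n)"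
  by (simp add: tensor_power_def)

lemma index_tensor_power:
  assumes "i < dA ^ n * dB ^ n" "j < dA ^ n * dB ^ n"
  shows "tensor_power dA dB n A $$ (i, j) = (\<Prod>k<n. A $$ (copy_index dA dB n k i, copy_index dA dB n k j))"
  using assms by (simp add: tensor_power_def)

lemma mtrace_tensor_power:
  assumes "0 < dA" "0 < dB" "A \<in> carrier_mat (dA * dB) (dA * dB)"
  shows "mtrace (tensor_power dA dB n A) = mtrace A ^ n"
  using sum_prod_copy_index[OF assms(1,2), where f = "\<lambda>k x. A $$ (x, x)" and n = n] assms(3)
  by (simp add: mtrace_sum[OF tensor_power_carrier] mtrace_sum[OF assms(3)] index_tensor_power)

lemma tensor_power_mult:
  assumes d: "0 < dA" "0 < dB"
    and A: "A \<in> carrier_mat (dA * dB) (dA * dB)" and B: "B \<in> carrier_mat (dA * dB) (dA * dB)"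
  shows "tensor_power dA dB n A * tensor_power dA dB n B = tensor_power dA dB n (A * B)"
proof (rule eq_matI)
  let ?N = "dA ^ n * dB ^ n" and ?c = "copy_index dA dB n"
  fix i j assume "i < dim_row (tensor_power dA dB n (A * B))" "j < dim_col (tensor_power dA dB n (A * B))"
  then have ij: "i < ?N" "j < ?N"
    by (auto simp: tensor_power_def)
  have "(tensor_power dA dB n A * tensor_power dA dB n B) $$ (i, j)
      = (\<Sum>m<?N. tensor_power dA dB n A $$ (i, m) * tensor_power dA dB n B $$ (m, j))"
    using ij by (subst index_mult_mat_sum) (auto simp: tensor_power_def)
  also have "\<dots> = (\<Sum>m<?N. \<Prod>k<n. A $$ (?c k i, ?c k m) * B $$ (?c k m, ?c k j))"
    using ij by (simp add: index_tensor_power prod.distrib)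
  also have "\<dots> = (\<Prod>k<n. \<Sum>x<dA * dB. A $$ (?c k i, x) * B $$ (x, ?c k j))"
    using sum_prod_copy_index[OF d, where f = "\<lambda>k x. A $$ (?c k i, x) * B $$ (x, ?c k j)" and n = n] by simp
  also have "\<dots> = tensor_power dA dB n (A * B) $$ (i, j)"
    unfolding index_tensor_power[OF ij] using copy_index_less[OF d] A B
    by (intro prod.cong refl, subst index_mult_mat_sum) auto
  finally show "(tensor_power dA dB n A * tensor_power dA dB n B) $$ (i, j) = tensor_power dA dB n (A * B) $$ (i, j)" .
qed (auto simp: tensor_power_def)

lemma mat_adjoint_tensor_power:
  assumes d: "0 < dA" "0 < dB" and A: "A \<in> carrier_mat (dA * dB) (dA * dB)"
  shows "mat_adjoint (tensor_power dA dB n A) = tensor_power dA dB n (mat_adjoint A)"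
  by (rule eq_matI) (use A copy_index_less[OF d] in \<open>auto simp: tensor_power_def\<close>)

lemma psd_tensor_power:
  assumes d: "0 < dA" "0 < dB" and A: "psd (dA * dB) A"
  shows "psd (dA ^ n * dB ^ n) (tensor_power dA dB n A)"
proof -
  obtain K where K: "pos_kernel K" "\<And>i j. i < dA * dB \<Longrightarrow> j < dA * dB \<Longrightarrow> A $$ (i, j) = K i j"
    using pos_kernel_of_psd[OF A] by blast
  show ?thesis
  proof (rule psd_of_pos_kernel)
    show "pos_kernel (\<lambda>i j. \<Prod>k<n. K (copy_index dA dB n k i) (copy_index dA dB n k j))"
      by (intro pos_kernel_prod pos_kernel_comp[OF K(1)])
  qed (simp_all add: index_tensor_power K(2) copy_index_less[OF d])
qed

lemma density_op_tensor_power: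
  assumes "0 < dA" "0 < dB" "density_op (dA * dB) A"
  shows "density_op (dA ^ n * dB ^ n) (tensor_power dA dB n A)"
  using assms by (simp add: density_op_def psd_tensor_power mtrace_tensor_power psd_def[of "dA * dB"])

lemma partial_transpose_carrier [simp]: "partial_transpose a b X \<in> carrier_mat (a * b) (a * b)"
  by (simp add: partial_transpose_def)

lemma index_partial_transpose:
  assumes "i < a * b" "j < a * b"
  shows "partial_transpose a b X $$ (i, j) = X $$ ((i div b) * b + j mod b, (j div b) * b + i mod b)"
  using assms by (simp add: partial_transpose_def)

lemma partial_transpose_tensor_power:
  assumes "0 < dA" "0 < dB"
  shows "partial_transpose (dA ^ n) (dB ^ n) (tensor_power dA dB n A)
    = tensor_power dA dB n (partial_transpose dA dB A)"
proof (rule eq_matI)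
  fix i j assume "i < dim_row (tensor_power dA dB n (partial_transpose dA dB A))"
    "j < dim_col (tensor_power dA dB n (partial_transpose dA dB A))"
  then have ij: "i < dA ^ n * dB ^ n" "j < dA ^ n * dB ^ n"
    by (auto simp: tensor_power_def)
  then show "partial_transpose (dA ^ n) (dB ^ n) (tensor_power dA dB n A) $$ (i, j)
      = tensor_power dA dB n (partial_transpose dA dB A) $$ (i, j)"
    using assms
    by (simp add: index_partial_transpose index_tensor_power mixed_index_less copy_index_mixed copy_index_less)
qed (auto simp: tensor_power_def partial_transpose_def)

text \<open>Partial transposition only permutes the terms of this pairing. It can therefore be moved
  from the state to the test operator.\<close>

lemma trace_partial_transpose:
  assumes "0 < b"
  shows "(\<Sum>i<a * b. \<Sum>j<a * b. partial_transpose a b X $$ (i, j) * partial_transpose a b Y $$ (j, i))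
    = (\<Sum>i<a * b. \<Sum>j<a * b. X $$ (i, j) * Y $$ (j, i))"
  using sum_mixed_index[OF assms, where f = "\<lambda>i j. X $$ (i, j) * Y $$ (j, i)" and a = a]
  by (simp add: index_partial_transpose)

subsection \<open>A lower bound on the relative entropy\<close>

lemma mtrace_mult_sum:
  assumes "A \<in> carrier_mat n n" "B \<in> carrier_mat n n"
  shows "mtrace (A * B) = (\<Sum>i<n. \<Sum>j<n. A $$ (i, j) * B $$ (j, i))"
  using assms by (subst mtrace_sum[of _ n]) (auto simp: index_mult_mat_sum simp del: index_mult_mat(1))

lemma mtrace_mult_comm:
  assumes "A \<in> carrier_mat n n" "B \<in> carrier_mat n n"
  shows "mtrace (A * B) = mtrace (B * A)"
  unfolding mtrace_mult_sum[OF assms] mtrace_mult_sum[OF assms(2,1)]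
  by (subst sum.swap) (simp add: mult.commute)

lemma index_adjoint_mult_mult:
  assumes A: "A \<in> carrier_mat n n" and B: "B \<in> carrier_mat n n" and k: "k < n"
  shows "(mat_adjoint A * B * A) $$ (k, k) = (\<Sum>i<n. \<Sum>j<n. cnj (A $$ (i, k)) * B $$ (i, j) * A $$ (j, k))"
proof -
  have "(mat_adjoint A * B * A) $$ (k, k) = (\<Sum>j<n. (mat_adjoint A * B) $$ (k, j) * A $$ (j, k))"
    using A B k by (subst index_mult_mat_sum) auto
  also have "\<dots> = (\<Sum>j<n. \<Sum>i<n. cnj (A $$ (i, k)) * B $$ (i, j) * A $$ (j, k))"
  proof (intro sum.cong refl)
    fix j assume "j \<in> {..<n}"
    then have "(mat_adjoint A * B) $$ (k, j) = (\<Sum>i<n. cnj (A $$ (i, k)) * B $$ (i, j))"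
      using A B k by (subst index_mult_mat_sum) auto
    then show "(mat_adjoint A * B) $$ (k, j) * A $$ (j, k) = (\<Sum>i<n. cnj (A $$ (i, k)) * B $$ (i, j) * A $$ (j, k))"
      by (simp add: sum_distrib_right)
  qed
  finally show ?thesis
    by (subst sum.swap)
qed

lemma psd_conjugate_diag_nonneg:
  assumes A: "A \<in> carrier_mat n n" and B: "psd n B" and k: "k < n"
  shows "0 \<le> (mat_adjoint A * B * A) $$ (k, k)"
  using psd_form_nonneg[OF B, of "\<lambda>i. A $$ (i, k)"] B
  by (subst index_adjoint_mult_mult[OF A _ k]) (auto simp: psd_def)

lemma mtrace_spectral_mult:
  assumes U: "U \<in> carrier_mat n n" and B: "B \<in> carrier_mat n n"
  shows "mtrace (U * mat_diag n a * mat_adjoint U * B) = (\<Sum>k<n. a k * (mat_adjoint U * B * U) $$ (k, k))"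
proof -
  have car: "U * mat_diag n a * mat_adjoint U \<in> carrier_mat n n"
    using U by simp
  have "mtrace (U * mat_diag n a * mat_adjoint U * B)
      = (\<Sum>j<n. \<Sum>i<n. (U * mat_diag n a * mat_adjoint U) $$ (j, i) * B $$ (i, j))"
    by (rule mtrace_mult_sum[OF car B])
  also have "\<dots> = (\<Sum>j<n. \<Sum>i<n. \<Sum>k<n. a k * (cnj (U $$ (i, k)) * B $$ (i, j) * U $$ (j, k)))"
    by (intro sum.cong refl, subst spectral_entry[OF U]) (auto simp: sum_distrib_left mult_ac)
  also have "\<dots> = (\<Sum>k<n. \<Sum>j<n. \<Sum>i<n. a k * (cnj (U $$ (i, k)) * B $$ (i, j) * U $$ (j, k)))"
    by (rule sum_rotate)
  also have "\<dots> = (\<Sum>k<n. \<Sum>i<n. \<Sum>j<n. a k * (cnj (U $$ (i, k)) * B $$ (i, j) * U $$ (j, k)))"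
    by (intro sum.cong refl sum.swap)
  also have "\<dots> = (\<Sum>k<n. a k * (mat_adjoint U * B * U) $$ (k, k))"
    by (intro sum.cong refl, subst index_adjoint_mult_mult[OF U B]) (auto simp: sum_distrib_left)
  finally show ?thesis .
qed

lemma index_conjugate_spectral:
  assumes E: "E \<in> carrier_mat n n" and V: "V \<in> carrier_mat n n" and k: "k < n"
  shows "(mat_adjoint E * (V * mat_diag n (\<lambda>i. complex_of_real (b i)) * mat_adjoint V) * E) $$ (k, k)
    = complex_of_real (\<Sum>l<n. (cmod ((mat_adjoint E * V) $$ (k, l)))\<^sup>2 * b l)"
proof -
  let ?T = "mat_adjoint E * V"
  have T: "?T \<in> carrier_mat n n"
    using E V by simp
  have "mat_adjoint E * (V * mat_diag n (\<lambda>i. complex_of_real (b i)) * mat_adjoint V) * E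
      = ?T * mat_diag n (\<lambda>i. complex_of_real (b i)) * mat_adjoint ?T"
    using E V by (simp add: mat_adjoint_mult[of _ n n _ n] assoc_mult_mat[of _ n n _ n _ n])
  then have "(mat_adjoint E * (V * mat_diag n (\<lambda>i. complex_of_real (b i)) * mat_adjoint V) * E) $$ (k, k)
      = (\<Sum>l<n. ?T $$ (k, l) * complex_of_real (b l) * cnj (?T $$ (k, l)))"
    using spectral_entry[OF T k k] by simp
  also have "\<dots> = (\<Sum>l<n. complex_of_real ((cmod (?T $$ (k, l)))\<^sup>2 * b l))"
    unfolding of_real_mult complex_norm_square by (simp add: mult_ac)
  finally show ?thesis
    by simp
qed

text \<open>The weights \<open>p i * w i j\<close> form a probability distribution, and
  \<open>w i j * s j\<close> has mass at most \<open>c\<close> on the rows with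
  \<open>p i > 0\<close>. The bound averages \<open>ln x \<le> x - 1\<close> at
  \<open>x = s j / (p i * c)\<close>; dividing by \<open>c\<close> normalises the second weight and
  produces the term \<open>- log 2 c\<close>. With \<open>w\<close> the squared overlaps of two
  eigenbases these are the Nussbaum-Szkola distributions.\<close>

lemma classical_relative_entropy_bound:
  fixes p s :: "nat \<Rightarrow> real" and w :: "nat \<Rightarrow> nat \<Rightarrow> real"
  assumes p: "\<And>i. i < n \<Longrightarrow> 0 \<le> p i" "(\<Sum>i<n. p i) = 1"
    and s: "\<And>j. j < n \<Longrightarrow> 0 \<le> s j"
    and w: "\<And>i j. i < n \<Longrightarrow> j < n \<Longrightarrow> 0 \<le> w i j" "\<And>i. i < n \<Longrightarrow> (\<Sum>j<n. w i j) = 1"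
    and supp: "\<And>i j. i < n \<Longrightarrow> j < n \<Longrightarrow> p i > 0 \<Longrightarrow> s j = 0 \<Longrightarrow> w i j = 0"
    and c: "0 < c" "(\<Sum>i<n. if 0 < p i then \<Sum>j<n. w i j * s j else 0) \<le> c"
  shows "- log 2 c \<le> (\<Sum>i<n. p i * log 2 (p i)) - (\<Sum>i<n. p i * (\<Sum>j<n. w i j * log 2 (s j)))"
proof -
  have *: "p i * w i j * (ln (s j) - ln (p i) - ln c) \<le> (if 0 < p i then w i j * s j else 0) / c - p i * w i j"
    if ij: "i < n" "j < n" for i j
  proof (cases "0 < p i \<and> w i j \<noteq> 0")
    case True
    \<comment> \<open>\<open>supp\<close> excludes \<open>s j = 0\<close>, where \<open>ln\<close>
      has the default value 0 in place of minus infinity.\<close>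
    then have pos: "0 < p i" "0 < s j" "0 < w i j"
      using supp[OF ij] s[OF ij(2)] w(1)[OF ij] by (auto simp: less_le)
    have "ln (s j) - ln (p i) - ln c = ln (s j / (p i * c))"
      using pos c(1) by (simp add: ln_div ln_mult)
    also have "\<dots> \<le> s j / (p i * c) - 1"
      using pos c(1) by (intro ln_le_minus_one) simp
    finally have "p i * w i j * (ln (s j) - ln (p i) - ln c) \<le> p i * w i j * (s j / (p i * c) - 1)"
      using pos by (intro mult_left_mono) auto
    also have "\<dots> = w i j * s j / c - p i * w i j"
      using pos c(1) by (simp add: field_simps)
    finally show ?thesis
      using pos by simp
  next
    case False
    then show ?thesis
      using p(1)[OF ij(1)] by (auto simp: less_le)
  qed
  have "(\<Sum>i<n. \<Sum>j<n. p i * w i j * (ln (s j) - ln (p i) - ln c))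
      \<le> (\<Sum>i<n. \<Sum>j<n. (if 0 < p i then w i j * s j else 0) / c - p i * w i j)"
    using * by (intro sum_mono) auto
  also have "\<dots> = (\<Sum>i<n. if 0 < p i then \<Sum>j<n. w i j * s j else 0) / c - 1"
  proof -
    have "(\<Sum>j<n. (if 0 < p i then w i j * s j else 0) / c - p i * w i j)
        = (if 0 < p i then \<Sum>j<n. w i j * s j else 0) / c - p i" if "i < n" for i
      using w(2)[OF that] by (simp add: sum_subtractf sum_divide_distrib[symmetric] sum_distrib_left[symmetric])
    then show ?thesis
      by (simp add: sum_subtractf sum_divide_distrib[symmetric] p(2))
  qed
  also have "\<dots> \<le> 0"
    using c by simp
  finally have "(\<Sum>i<n. \<Sum>j<n. p i * w i j * (ln (s j) - ln (p i) - ln c)) \<le> 0" .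
  moreover have "(\<Sum>i<n. \<Sum>j<n. p i * w i j * (ln (s j) - ln (p i) - ln c))
      = (\<Sum>i<n. p i * (\<Sum>j<n. w i j * ln (s j))) - (\<Sum>i<n. p i * ln (p i)) - ln c"
  proof -
    have "(\<Sum>j<n. p i * w i j * (ln (s j) - ln (p i) - ln c))
        = p i * (\<Sum>j<n. w i j * ln (s j)) - p i * ln (p i) - p i * ln c" if "i < n" for i
    proof -
      have "(\<Sum>j<n. p i * w i j * (ln (s j) - ln (p i) - ln c))
          = (\<Sum>j<n. p i * (w i j * ln (s j)) - p i * (ln (p i) + ln c) * w i j)"
        by (intro sum.cong refl) (simp add: algebra_simps)
      also have "\<dots> = p i * (\<Sum>j<n. w i j * ln (s j)) - p i * (ln (p i) + ln c) * (\<Sum>j<n. w i j)"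
        by (simp only: sum_subtractf sum_distrib_left)
      finally show ?thesis
        using w(2)[OF that] by (simp add: distrib_left)
    qed
    then show ?thesis
      by (simp add: sum_subtractf sum_distrib_right[symmetric] p(2))
  qed
  ultimately have "- ln c \<le> (\<Sum>i<n. p i * ln (p i)) - (\<Sum>i<n. p i * (\<Sum>j<n. w i j * ln (s j)))"
    by simp
  then have "- ln c / ln 2 \<le> ((\<Sum>i<n. p i * ln (p i)) - (\<Sum>i<n. p i * (\<Sum>j<n. w i j * ln (s j)))) / ln 2"
    by (intro divide_right_mono) auto
  then show ?thesis
    by (simp add: log_def diff_divide_distrib sum_divide_distrib sum_distrib_left)
qed


section \<open>Relative entropy through the overlaps of two eigenbases\<close>

lemma spectral_mult:
  assumes U: "unitary n U"
  shows "(U * mat_diag n a * mat_adjoint U) * (U * mat_diag n b * mat_adjoint U)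
    = U * mat_diag n (\<lambda>i. a i * b i) * mat_adjoint U"
proof -
  note Uc = unitaryD[OF U]
  have "(U * mat_diag n a * mat_adjoint U) * (U * mat_diag n b * mat_adjoint U)
      = U * mat_diag n a * (mat_adjoint U * U) * mat_diag n b * mat_adjoint U"
    using Uc(1) by (simp add: assoc_mult_mat[of _ n n _ n _ n])
  also have "\<dots> = U * (mat_diag n a * mat_diag n b) * mat_adjoint U"
    using Uc by (simp add: right_mult_one_mat[of _ n n] assoc_mult_mat[of _ n n _ n _ n])
  finally show ?thesis
    by simp
qed

lemma mtrace_minus:
  assumes "A \<in> carrier_mat n n" "B \<in> carrier_mat n n"
  shows "mtrace (A - B) = mtrace A - mtrace B"
  using assms by (simp add: mtrace_sum[OF minus_carrier_mat[OF assms(2)]] mtrace_sum[of _ n] sum_subtractf)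

lemma rel_entropy_spectral:
  assumes U: "unitary n U" and W: "unitary n W"
    and \<rho>: "\<rho> = U * mat_diag n (\<lambda>i. complex_of_real (p i)) * mat_adjoint U"
    and \<sigma>: "\<sigma> = W * mat_diag n (\<lambda>i. complex_of_real (s i)) * mat_adjoint W"
    and supp: "mat_supp \<rho> \<subseteq> mat_supp \<sigma>"
  shows "rel_entropy \<rho> \<sigma> = ereal ((\<Sum>i<n. p i * log 2 (p i))
    - (\<Sum>i<n. p i * (\<Sum>j<n. (cmod ((mat_adjoint U * W) $$ (i, j)))\<^sup>2 * log 2 (s j))))"
proof -
  note Uc = unitaryD(1)[OF U] and Wc = unitaryD(1)[OF W]
  let ?L = "W * mat_diag n (\<lambda>i. complex_of_real (log 2 (s i))) * mat_adjoint W"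
  have "mtrace (\<rho> * mat_fun (log 2) \<rho>) = complex_of_real (\<Sum>i<n. p i * log 2 (p i))"
    by (simp add: mat_fun_spectral[OF U \<rho>]) (simp add: \<rho> spectral_mult[OF U] mtrace_spectral[OF U])
  moreover have "mtrace (\<rho> * ?L)
      = complex_of_real (\<Sum>i<n. p i * (\<Sum>j<n. (cmod ((mat_adjoint U * W) $$ (i, j)))\<^sup>2 * log 2 (s j)))"
    unfolding \<rho> using Uc Wc
    by (subst mtrace_spectral_mult) (auto simp: index_conjugate_spectral simp del: index_mult_mat(1))
  moreover have "mtrace (\<rho> * mat_fun (log 2) \<rho> - \<rho> * mat_fun (log 2) \<sigma>)
      = mtrace (\<rho> * mat_fun (log 2) \<rho>) - mtrace (\<rho> * ?L)"
    unfolding mat_fun_spectral[OF W \<sigma>]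
  proof (rule mtrace_minus)
    have \<rho>c: "\<rho> \<in> carrier_mat n n"
      using Uc by (simp add: \<rho>)
    moreover have "mat_fun (log 2) \<rho> \<in> carrier_mat n n"
      using Uc by (simp add: mat_fun_spectral[OF U \<rho>])
    ultimately show "\<rho> * mat_fun (log 2) \<rho> \<in> carrier_mat n n"
      by simp
    show "\<rho> * ?L \<in> carrier_mat n n"
      using \<rho>c Wc by simp
  qed
  ultimately show ?thesis
    using supp by (simp add: rel_entropy_def)
qed

text \<open>Column \<open>i\<close> of \<open>U\<close> lies, up to the nonzero factor
  \<open>p i\<close>, in the range of \<open>\<sigma>\<close>, and this range is orthogonal to the
  kernel vector in column \<open>j\<close> of \<open>W\<close>.\<close>

lemma mat_supp_overlap_zero:
  assumes U: "unitary n U" and W: "unitary n W"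
    and \<rho>: "\<rho> = U * mat_diag n (\<lambda>i. complex_of_real (p i)) * mat_adjoint U"
    and \<sigma>: "\<sigma> = W * mat_diag n (\<lambda>i. complex_of_real (s i)) * mat_adjoint W"
    and supp: "mat_supp \<rho> \<subseteq> mat_supp \<sigma>"
    and i: "i < n" and j: "j < n" and "p i \<noteq> 0" and "s j = 0"
  shows "(mat_adjoint U * W) $$ (i, j) = 0"
proof -
  note Uc = unitaryD[OF U] and Wc = unitaryD[OF W]
  have \<rho>c: "\<rho> \<in> carrier_mat n n" and \<sigma>c: "\<sigma> \<in> carrier_mat n n"
    using Uc Wc by (simp_all add: \<rho> \<sigma>)
  have "\<rho> *\<^sub>v col U i \<in> mat_supp \<rho>"
    using \<rho>c Uc(1) col_dim[of U i] by (auto simp: mat_supp_def)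
  then obtain x where x: "x \<in> carrier_vec n" and eq: "\<rho> *\<^sub>v col U i = \<sigma> *\<^sub>v x"
    using supp \<sigma>c by (auto simp: mat_supp_def)
  have "\<rho> * U = U * mat_diag n (\<lambda>i. complex_of_real (p i)) * (mat_adjoint U * U)"
    unfolding \<rho> using Uc(1) by (simp add: assoc_mult_mat[of _ n n _ n _ n])
  also have "\<dots> = U * mat_diag n (\<lambda>i. complex_of_real (p i))"
    using Uc by (simp add: right_mult_one_mat[of _ n n])
  finally have \<rho>U: "\<rho> * U = U * mat_diag n (\<lambda>i. complex_of_real (p i))" .
  have Ws: "mat_adjoint W * \<sigma> = mat_diag n (\<lambda>i. complex_of_real (s i)) * mat_adjoint W"
  proof -
    have "mat_adjoint W * \<sigma> = (mat_adjoint W * W) * mat_diag n (\<lambda>i. complex_of_real (s i)) * mat_adjoint W"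
      unfolding \<sigma> using Wc(1) by (simp add: assoc_mult_mat[of _ n n _ n _ n])
    then show ?thesis
      using Wc by (simp add: left_mult_one_mat[of _ n n])
  qed
  have zero: "row (mat_adjoint W * \<sigma>) j = 0\<^sub>v n"
    unfolding Ws using Wc(1) j \<open>s j = 0\<close> by (intro eq_vecI) (auto simp: mat_diag_mult_left[of _ n n])
  have "(mat_adjoint W *\<^sub>v (\<sigma> *\<^sub>v x)) $ j = ((mat_adjoint W * \<sigma>) *\<^sub>v x) $ j"
    using Wc(1) \<sigma>c x by (simp add: assoc_mult_mat_vec[of _ n n _ n])
  also have "\<dots> = row (mat_adjoint W * \<sigma>) j \<bullet> x"
    using Wc(1) \<sigma>c x j by (intro index_mult_mat_vec) simp
  also have "\<dots> = 0"
    using zero x by simp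
  finally have "(mat_adjoint W *\<^sub>v (\<rho> *\<^sub>v col U i)) $ j = 0"
    using eq by simp
  moreover have "\<rho> *\<^sub>v col U i = complex_of_real (p i) \<cdot>\<^sub>v col U i"
  proof -
    have "\<rho> *\<^sub>v col U i = col (\<rho> * U) i"
      using \<rho>c Uc(1) i by (intro col_mult2[symmetric, of _ n n _ n]) auto
    then show ?thesis
      unfolding \<rho>U using Uc(1) i by (intro eq_vecI) (auto simp: mat_diag_mult_right[of _ n])
  qed
  ultimately have "(\<Sum>k<n. cnj (W $$ (k, j)) * U $$ (k, i)) = 0"
  proof -
    assume *: "(mat_adjoint W *\<^sub>v (\<rho> *\<^sub>v col U i)) $ j = 0"
      "\<rho> *\<^sub>v col U i = complex_of_real (p i) \<cdot>\<^sub>v col U i"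
    have "(mat_adjoint W *\<^sub>v (\<rho> *\<^sub>v col U i)) $ j = complex_of_real (p i) * (\<Sum>k<n. cnj (W $$ (k, j)) * U $$ (k, i))"
      unfolding *(2) using Wc(1) Uc(1) i j
      by (subst index_mult_mat_vec_sum) (auto simp: sum_distrib_left mult_ac intro!: sum.cong)
    then show ?thesis
      using *(1) \<open>p i \<noteq> 0\<close> by simp
  qed
  then have "cnj (\<Sum>k<n. cnj (W $$ (k, j)) * U $$ (k, i)) = 0"
    by simp
  then show ?thesis
    using Uc(1) Wc(1) i j by (subst index_mult_mat_sum) (auto simp: mult.commute)
qed

text \<open>By the data processing inequality for the measurement \<open>{P, 1 - P}\<close>; the proof uses only
  \<open>ln x \<le> x - 1\<close> on the joint distribution of the two eigenbases.\<close>

lemma rel_entropy_ge_projection: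
  assumes \<rho>: "density_op n \<rho>" and \<sigma>: "psd n \<sigma>"
    and P: "P \<in> carrier_mat n n" "mat_adjoint P = P" "P * P = P" "P * \<rho> = \<rho>"
    and c: "0 < c" "Re (mtrace (P * \<sigma>)) \<le> c"
  shows "ereal (- log 2 c) \<le> rel_entropy \<rho> \<sigma>"
proof (cases "mat_supp \<rho> \<subseteq> mat_supp \<sigma>")
  case False
  then show ?thesis
    by (simp add: rel_entropy_def)
next
  case True
  have \<rho>psd: "psd n \<rho>" and tr: "mtrace \<rho> = 1"
    using \<rho> by (auto simp: density_op_def)
  have car: "\<rho> \<in> carrier_mat n n" "\<sigma> \<in> carrier_mat n n"
    using \<rho>psd \<sigma> by (auto simp: psd_def)
  obtain U p where U: "unitary n U" and \<rho>U: "\<rho> = U * mat_diag n (\<lambda>i. complex_of_real (p i)) * mat_adjoint U"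
    and p: "\<And>i. i < n \<Longrightarrow> 0 \<le> p i"
    using psd_spectral[OF \<rho>psd] by blast
  obtain W s where W: "unitary n W" and \<sigma>W: "\<sigma> = W * mat_diag n (\<lambda>i. complex_of_real (s i)) * mat_adjoint W"
    and s: "\<And>i. i < n \<Longrightarrow> 0 \<le> s i"
    using psd_spectral[OF \<sigma>] by blast
  note Uc = unitaryD[OF U] and Wc = unitaryD[OF W]
  define w where "w i j = (cmod ((mat_adjoint U * W) $$ (i, j)))\<^sup>2" for i j
  have sum_p: "(\<Sum>i<n. p i) = 1"
    using tr unfolding \<rho>U mtrace_spectral[OF U] by (simp flip: of_real_sum)
  have sum_w: "(\<Sum>j<n. w i j) = 1" if i: "i < n" for i
  proof -
    have "mat_adjoint U * (W * mat_diag n (\<lambda>i. complex_of_real 1) * mat_adjoint W) * U = 1\<^sub>m n"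
      using Uc Wc by (simp add: right_mult_one_mat[of _ n n])
    then have "complex_of_real (\<Sum>j<n. w i j) = 1"
      using index_conjugate_spectral[OF Uc(1) Wc(1) i, of "\<lambda>_. 1"] i by (simp add: w_def)
    then show ?thesis
      by (simp only: of_real_eq_1_iff)
  qed
  \<comment> \<open>Since \<open>P * \<rho> = \<rho>\<close>, eigenvectors of \<open>\<rho>\<close>
    with positive eigenvalue are fixed by \<open>P\<close>: the factor \<open>p k\<close> cancels in
    column \<open>k\<close> of \<open>P * U * ?D = U * ?D\<close>.\<close>
  have PU: "(P * U) $$ (x, k) = U $$ (x, k)" if "x < n" "k < n" "0 < p k" for x k
  proof -
    let ?D = "mat_diag n (\<lambda>i. complex_of_real (p i))"
    have \<rho>U': "\<rho> * U = U * ?D"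
    proof -
      have "\<rho> * U = U * ?D * (mat_adjoint U * U)"
        unfolding \<rho>U using Uc(1) by (simp add: assoc_mult_mat[of _ n n _ n _ n])
      then show ?thesis
        using Uc by (simp add: right_mult_one_mat[of _ n n])
    qed
    have "P * U * ?D = P * (\<rho> * U)"
      unfolding \<rho>U' using P(1) Uc(1) by (simp add: assoc_mult_mat[of _ n n _ n _ n])
    also have "\<dots> = U * ?D"
      using assoc_mult_mat[OF P(1) car(1) Uc(1)] P(4) \<rho>U' by simp
    finally have "(P * U * ?D) $$ (x, k) = (U * ?D) $$ (x, k)"
      by simp
    then show ?thesis
      using that P(1) Uc(1) by (simp add: mat_diag_mult_right[of _ n] del: index_mult_mat(1))
  qed
  \<comment> \<open>The trace of \<open>P * \<sigma>\<close> is a sum over the columns of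
    \<open>P * U\<close>. Columns with \<open>p k > 0\<close> agree with those of \<open>U\<close>
    and give the left side; the others contribute nonnegative terms.\<close>
  have "(\<Sum>i<n. if 0 < p i then \<Sum>j<n. w i j * s j else 0) \<le> Re (mtrace (P * \<sigma>))"
  proof -
    let ?Q = "P * U"
    have Qc: "?Q \<in> carrier_mat n n"
      using P(1) Uc(1) by simp
    have "mtrace (P * \<sigma>) = mtrace (P * (P * \<sigma>))"
      using assoc_mult_mat[OF P(1) P(1) car(2)] P(3) by simp
    also have "\<dots> = mtrace (P * \<sigma> * P)"
      using P(1) car by (intro mtrace_mult_comm[of _ n]) auto
    also have "\<dots> = mtrace (U * mat_diag n (\<lambda>_. 1) * mat_adjoint U * (P * \<sigma> * P))"
      using Uc P(1) car by (simp add: right_mult_one_mat[of _ n n] left_mult_one_mat[of _ n n])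
    also have "\<dots> = (\<Sum>k<n. (mat_adjoint U * (P * \<sigma> * P) * U) $$ (k, k))"
      using Uc(1) P(1) car by (subst mtrace_spectral_mult) auto
    also have "mat_adjoint U * (P * \<sigma> * P) * U = mat_adjoint ?Q * \<sigma> * ?Q"
      using Uc(1) P(1,2) car by (simp add: mat_adjoint_mult[of _ n n _ n] assoc_mult_mat[of _ n n _ n _ n])
    finally have eq: "mtrace (P * \<sigma>) = (\<Sum>k<n. (mat_adjoint ?Q * \<sigma> * ?Q) $$ (k, k))" .
    have "(if 0 < p k then \<Sum>j<n. w k j * s j else 0) \<le> Re ((mat_adjoint ?Q * \<sigma> * ?Q) $$ (k, k))"
      if k: "k < n" for k
    proof (cases "0 < p k")
      case True
      have "(mat_adjoint ?Q * \<sigma> * ?Q) $$ (k, k) = (mat_adjoint U * \<sigma> * U) $$ (k, k)"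
        unfolding index_adjoint_mult_mult[OF Qc car(2) k] index_adjoint_mult_mult[OF Uc(1) car(2) k]
        using PU[OF _ k True] by (simp del: index_mult_mat(1))
      also have "\<dots> = complex_of_real (\<Sum>j<n. w k j * s j)"
        unfolding \<sigma>W w_def by (rule index_conjugate_spectral[OF Uc(1) Wc(1) k])
      finally show ?thesis
        using True by simp
    next
      case False
      then show ?thesis
        using psd_conjugate_diag_nonneg[OF Qc \<sigma> k] by (simp add: less_eq_complex_def)
    qed
    then show ?thesis
      unfolding eq by (auto intro: sum_mono)
  qed
  then have tc: "(\<Sum>i<n. if 0 < p i then \<Sum>j<n. w i j * s j else 0) \<le> c"
    using c(2) by simp
  have supp: "w i j = 0" if "i < n" "j < n" "0 < p i" "s j = 0" for i j
    using mat_supp_overlap_zero[OF U W \<rho>U \<sigma>W True that(1,2)] that by (simp add: w_def)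
  have "- log 2 c \<le> (\<Sum>i<n. p i * log 2 (p i)) - (\<Sum>i<n. p i * (\<Sum>j<n. w i j * log 2 (s j)))"
    by (rule classical_relative_entropy_bound[OF p sum_p s _ sum_w supp c(1) tc]) (simp_all add: w_def)
  then show ?thesis
    unfolding rel_entropy_spectral[OF U W \<rho>U \<sigma>W True] w_def by simp
qed

subsection \<open>An upper bound on the Rains bound\<close>

lemma psd_smult:
  assumes "psd n A" "0 \<le> c"
  shows "psd n (complex_of_real c \<cdot>\<^sub>m A)"
proof (rule psdI)
  have A: "A \<in> carrier_mat n n"
    using assms(1) by (simp add: psd_def)
  then show "complex_of_real c \<cdot>\<^sub>m A \<in> carrier_mat n n"
    by simp
  fix f :: "nat \<Rightarrow> complex"
  have "0 \<le> complex_of_real c * (\<Sum>i<n. \<Sum>j<n. cnj (f i) * A $$ (i, j) * f j)"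
    using psd_form_nonneg[OF assms(1), of f] assms(2) by (intro mult_nonneg_nonneg) (auto simp: less_eq_complex_def)
  also have "\<dots> = (\<Sum>i<n. \<Sum>j<n. cnj (f i) * (complex_of_real c \<cdot>\<^sub>m A) $$ (i, j) * f j)"
    using A by (simp add: sum_distrib_left mult_ac)
  finally show "0 \<le> (\<Sum>i<n. \<Sum>j<n. cnj (f i) * (complex_of_real c \<cdot>\<^sub>m A) $$ (i, j) * f j)" .
qed

text \<open>Both operators share an eigenbasis, and their logarithms differ by the constant
  \<open>log 2 t\<close> on the support of \<open>\<rho>\<close>; zero eigenvalues carry weight
  zero.\<close>

lemma rel_entropy_scaled:
  assumes \<rho>: "density_op n \<rho>" and t: "0 < t"
  shows "rel_entropy \<rho> (complex_of_real (1 / t) \<cdot>\<^sub>m \<rho>) = ereal (log 2 t)"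
proof -
  let ?\<sigma> = "complex_of_real (1 / t) \<cdot>\<^sub>m \<rho>"
  have \<rho>psd: "psd n \<rho>" and tr: "mtrace \<rho> = 1"
    using \<rho> by (auto simp: density_op_def)
  have car: "\<rho> \<in> carrier_mat n n"
    using \<rho>psd by (auto simp: psd_def)
  obtain U p where U: "unitary n U" and \<rho>U: "\<rho> = U * mat_diag n (\<lambda>i. complex_of_real (p i)) * mat_adjoint U"
    and p: "\<And>i. i < n \<Longrightarrow> 0 \<le> p i"
    using psd_spectral[OF \<rho>psd] by blast
  note Uc = unitaryD[OF U]
  have \<sigma>U: "?\<sigma> = U * mat_diag n (\<lambda>i. complex_of_real (p i / t)) * mat_adjoint U"
  proof (rule eq_matI)
    fix i j assume "i < dim_row (U * mat_diag n (\<lambda>i. complex_of_real (p i / t)) * mat_adjoint U)"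
      "j < dim_col (U * mat_diag n (\<lambda>i. complex_of_real (p i / t)) * mat_adjoint U)"
    then have ij: "i < n" "j < n"
      using Uc(1) by auto
    then show "?\<sigma> $$ (i, j) = (U * mat_diag n (\<lambda>i. complex_of_real (p i / t)) * mat_adjoint U) $$ (i, j)"
      unfolding spectral_entry[OF Uc(1) ij] using car spectral_entry[OF Uc(1) ij, of "\<lambda>i. complex_of_real (p i)"]
      by (simp add: \<rho>U[symmetric] sum_divide_distrib mult_ac del: index_mult_mat(1))
  qed (use car Uc in auto)
  have supp: "mat_supp \<rho> \<subseteq> mat_supp ?\<sigma>"
  proof
    fix y assume "y \<in> mat_supp \<rho>"
    then obtain v where v: "v \<in> carrier_vec n" "y = \<rho> *\<^sub>v v"
      using car by (auto simp: mat_supp_def)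
    have "y = ?\<sigma> *\<^sub>v (complex_of_real t \<cdot>\<^sub>v v)"
      using v car t by (intro eq_vecI) (auto simp: index_mult_mat_vec_sum sum_distrib_left mult_ac simp del: index_mult_mat_vec)
    then show "y \<in> mat_supp ?\<sigma>"
      using v car by (auto simp: mat_supp_def)
  qed
  have sum_p: "(\<Sum>i<n. p i) = 1"
    using tr unfolding \<rho>U mtrace_spectral[OF U] by (simp flip: of_real_sum)
  have "(\<Sum>j<n. (cmod ((mat_adjoint U * U) $$ (i, j)))\<^sup>2 * log 2 (p j / t)) = log 2 (p i / t)" if "i < n" for i
  proof -
    have "(\<Sum>j<n. (cmod ((mat_adjoint U * U) $$ (i, j)))\<^sup>2 * log 2 (p j / t))
        = (\<Sum>j<n. if j = i then log 2 (p j / t) else 0)"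
      using that Uc(2) by (intro sum.cong) auto
    then show ?thesis
      using that by simp
  qed
  then have "rel_entropy \<rho> ?\<sigma> = ereal ((\<Sum>i<n. p i * log 2 (p i)) - (\<Sum>i<n. p i * log 2 (p i / t)))"
    unfolding rel_entropy_spectral[OF U U \<rho>U \<sigma>U supp] by simp
  also have "(\<Sum>i<n. p i * log 2 (p i)) - (\<Sum>i<n. p i * log 2 (p i / t)) = (\<Sum>i<n. p i * log 2 t)"
    unfolding sum_subtractf[symmetric]
  proof (intro sum.cong refl)
    fix i assume "i \<in> {..<n}"
    then show "p i * log 2 (p i) - p i * log 2 (p i / t) = p i * log 2 t"
      using p[of i] t by (cases "p i = 0") (auto simp: log_divide algebra_simps)
  qed
  also have "\<dots> = log 2 t"
    by (simp add: sum_distrib_right[symmetric] sum_p)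
  finally show ?thesis .
qed

text \<open>The feasible point is \<open>\<rho>\<close> divided by the trace of \<open>Z\<close>,
  with \<open>Z\<close> as the certificate for \<open>trace_norm_le\<close>.\<close>

lemma rains_le:
  assumes \<rho>: "density_op (a * b) \<rho>" and Z: "Z \<in> carrier_mat (a * b) (a * b)" "0 < Re (mtrace Z)"
    and "psd (a * b) (Z - partial_transpose a b \<rho>)" "psd (a * b) (Z + partial_transpose a b \<rho>)" and b: "0 < b"
  shows "rains a b \<rho> \<le> ereal (log 2 (Re (mtrace Z)))"
proof -
  let ?n = "a * b" and ?t = "Re (mtrace Z)"
  let ?c = "complex_of_real (1 / ?t)"
  let ?X = "partial_transpose a b (?c \<cdot>\<^sub>m \<rho>)"
  have \<rho>psd: "psd ?n \<rho>"
    using \<rho> by (auto simp: density_op_def)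
  have car: "\<rho> \<in> carrier_mat ?n ?n"
    using \<rho>psd by (auto simp: psd_def)
  have X: "?X = ?c \<cdot>\<^sub>m partial_transpose a b \<rho>"
    using car b by (intro eq_matI) (auto simp: partial_transpose_def mixed_index_less)
  have herm: "mat_adjoint ?X = ?X"
    using car b psd_hermitian_entry[OF \<rho>psd]
    by (intro eq_matI) (auto simp: partial_transpose_def mixed_index_less simp flip: psd_hermitian_entry[OF \<rho>psd])
  have "trace_norm ?X \<le> Re (mtrace (?c \<cdot>\<^sub>m Z))"
  proof (rule trace_norm_le[OF partial_transpose_carrier herm])
    have "?c \<cdot>\<^sub>m Z - ?X = ?c \<cdot>\<^sub>m (Z - partial_transpose a b \<rho>)"
      unfolding X using Z(1) by (intro eq_matI) (auto simp: partial_transpose_def diff_divide_distrib)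
    then show "psd ?n (?c \<cdot>\<^sub>m Z - ?X)"
      using psd_smult[OF assms(4), of "1 / ?t"] Z(2) by simp
    have "?c \<cdot>\<^sub>m Z + ?X = ?c \<cdot>\<^sub>m (Z + partial_transpose a b \<rho>)"
      unfolding X using Z(1) by (intro eq_matI) (auto simp: partial_transpose_def add_divide_distrib)
    then show "psd ?n (?c \<cdot>\<^sub>m Z + ?X)"
      using psd_smult[OF assms(5), of "1 / ?t"] Z(2) by simp
  qed (use Z in simp)
  also have "mtrace (?c \<cdot>\<^sub>m Z) = ?c * mtrace Z"
    using Z(1) by (simp add: mtrace_sum[of _ ?n] sum_divide_distrib)
  also have "Re (?c * mtrace Z) = 1"
    using Z(2) by simp
  finally have "trace_norm ?X \<le> 1" .
  moreover have "psd ?n (?c \<cdot>\<^sub>m \<rho>)"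
    using psd_smult[OF \<rho>psd, of "1 / ?t"] Z(2) by simp
  ultimately have "rains a b \<rho> \<le> rel_entropy \<rho> (?c \<cdot>\<^sub>m \<rho>)"
    unfolding rains_def by (intro INF_lower) simp
  then show ?thesis
    using rel_entropy_scaled[OF \<rho> Z(2)] by simp
qed


subsection \<open>Two-dimensional antisymmetric subspaces of two qutrits\<close>

abbreviation unit_vec3 :: "(nat \<Rightarrow> complex) \<Rightarrow> bool" where
  "unit_vec3 u \<equiv> u 0 * cnj (u 0) + u 1 * cnj (u 1) + u 2 * cnj (u 2) = 1"

text \<open>The matrix of the cross product with the conjugate of \<open>u\<close>. As a vector of
  \<open>\<complex>\<^sup>3 \<otimes> \<complex>\<^sup>3\<close> of squared norm 2 it spans the complement of \<open>u \<and> \<complex>\<^sup>3\<close>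
  in the antisymmetric subspace.\<close>

definition axial :: "(nat \<Rightarrow> complex) \<Rightarrow> nat \<Rightarrow> nat \<Rightarrow> complex" where
  "axial u i j = (if i = 0 \<and> j = 1 then cnj (u 2) else if i = 1 \<and> j = 0 then - cnj (u 2)
    else if i = 2 \<and> j = 0 then cnj (u 1) else if i = 0 \<and> j = 2 then - cnj (u 1)
    else if i = 1 \<and> j = 2 then cnj (u 0) else if i = 2 \<and> j = 1 then - cnj (u 0) else 0)"

definition axial_vec :: "(nat \<Rightarrow> complex) \<Rightarrow> nat \<Rightarrow> complex" where
  "axial_vec u I = axial u (I div 3) (I mod 3)"

definition flip :: "nat \<Rightarrow> nat" where
  "flip I = (I mod 3) * 3 + I div 3"

definition reflection :: "(nat \<Rightarrow> complex) \<Rightarrow> nat \<Rightarrow> nat \<Rightarrow> complex" where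
  "reflection u I J = (if I = J then 1 else 0) - axial_vec u I * cnj (axial_vec u J)"

definition swap_kernel :: "nat \<Rightarrow> nat \<Rightarrow> complex" where
  "swap_kernel I J = (if I div 3 = J mod 3 \<and> I mod 3 = J div 3 then 1 else 0)"

definition wedge_projection :: "(nat \<Rightarrow> complex) \<Rightarrow> complex mat" where
  "wedge_projection u = mat 9 9 (\<lambda>(I, J). (reflection u I J - swap_kernel I J) / 2)"

lemma less_three_cases: "(i :: nat) < 3 \<Longrightarrow> i = 0 \<or> i = 1 \<or> i = 2"
  by auto

lemma sum_less_three: "(\<Sum>i<(3 :: nat). f i) = f 0 + f 1 + (f 2 :: 'a :: comm_monoid_add)"
  by (simp add: eval_nat_numeral add_ac)

lemma sum_less_nine:
  "(\<Sum>I<(9 :: nat). f I) = (\<Sum>i<3. \<Sum>j<3. (f (3 * i + j) :: 'a :: comm_monoid_add))"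
  by (simp add: eval_nat_numeral add_ac)

lemma flip_less: "I < 9 \<Longrightarrow> flip I < 9"
  by (auto simp: flip_def)

lemma flip_div_mod: "I < 9 \<Longrightarrow> flip I div 3 = I mod 3" "I < 9 \<Longrightarrow> flip I mod 3 = I div 3"
  by (auto simp: flip_def)

lemma swap_kernel_flip: "I < 9 \<Longrightarrow> J < 9 \<Longrightarrow> swap_kernel I J = (if J = flip I then 1 else 0)"
  by (auto simp: swap_kernel_def flip_def)

lemma swap_kernel_flip': "I < 9 \<Longrightarrow> J < 9 \<Longrightarrow> swap_kernel I J = (if I = flip J then 1 else 0)"
  unfolding swap_kernel_def flip_def by (metis div_mult_mod_eq flip_def flip_div_mod)

lemma flip_flip: "I < 9 \<Longrightarrow> flip (flip I) = I"
  by (auto simp: flip_def)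

lemma axial_antisym: "axial u j i = - axial u i j"
  by (auto simp: axial_def)

lemma axial_vec_flip: "I < 9 \<Longrightarrow> axial_vec u (flip I) = - axial_vec u I"
  by (simp add: axial_vec_def flip_div_mod axial_antisym[of u "I mod 3"])

lemma axial_vec_norm:
  assumes "unit_vec3 u"
  shows "(\<Sum>I<9. cnj (axial_vec u I) * axial_vec u I) = 2"
proof -
  have "(\<Sum>I<9. cnj (axial_vec u I) * axial_vec u I) = 2 * (u 0 * cnj (u 0) + u 1 * cnj (u 1) + u 2 * cnj (u 2))"
    by (simp add: sum_less_nine sum_less_three axial_vec_def axial_def algebra_simps)
  then show ?thesis
    by (simp only: assms mult_1_right)
qed

lemma reflection_apply:
  "I < 9 \<Longrightarrow> (\<Sum>K<9. reflection u I K * h K) = h I - axial_vec u I * (\<Sum>K<9. cnj (axial_vec u K) * h K)"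
  by (simp add: reflection_def left_diff_distrib sum_subtractf sum_distrib_left mult.assoc if_distrib[of "\<lambda>x. x * _"] cong: if_cong)

lemma swap_kernel_apply:
  assumes "I < 9"
  shows "(\<Sum>K<9. swap_kernel I K * h K) = h (flip I)"
proof -
  have "(\<Sum>K<9. swap_kernel I K * h K) = (\<Sum>K<9. if K = flip I then h K else 0)"
    using assms by (intro sum.cong) (auto simp: swap_kernel_flip)
  then show ?thesis
    using flip_less[OF assms] by simp
qed

text \<open>On such \<open>h\<close> the reflection acts as 1 and the swap as -1, so half their
  difference acts as 1.\<close>

lemma wedge_projection_apply:
  assumes "I < 9" "h (flip I) = - h I" "(\<Sum>K<9. cnj (axial_vec u K) * h K) = 0"
  shows "(\<Sum>K<9. wedge_projection u $$ (I, K) * h K) = h I"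
proof -
  have "(\<Sum>K<9. wedge_projection u $$ (I, K) * h K)
      = ((\<Sum>K<9. reflection u I K * h K) - (\<Sum>K<9. swap_kernel I K * h K)) / 2"
    using assms(1) by (simp add: wedge_projection_def diff_divide_distrib left_diff_distrib sum_subtractf sum_divide_distrib)
  then show ?thesis
    using assms by (simp add: reflection_apply swap_kernel_apply)
qed

lemma wedge_projection_carrier [simp]: "wedge_projection u \<in> carrier_mat 9 9"
  "dim_row (wedge_projection u) = 9" "dim_col (wedge_projection u) = 9"
  by (simp_all add: wedge_projection_def)

lemma wedge_projection_fixes:
  assumes A: "A \<in> carrier_mat 9 9"
    and "\<And>I J. I < 9 \<Longrightarrow> J < 9 \<Longrightarrow> A $$ (flip I, J) = - A $$ (I, J)"
    and "\<And>J. J < 9 \<Longrightarrow> (\<Sum>K<9. cnj (axial_vec u K) * A $$ (K, J)) = 0"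
  shows "wedge_projection u * A = A"
proof (rule eq_matI)
  fix I J assume "I < dim_row A" "J < dim_col A"
  then have IJ: "I < 9" "J < 9"
    using A by auto
  have "(wedge_projection u * A) $$ (I, J) = (\<Sum>K<9. wedge_projection u $$ (I, K) * A $$ (K, J))"
    using A IJ by (subst index_mult_mat_sum) auto
  also have "\<dots> = A $$ (I, J)"
    using IJ assms by (intro wedge_projection_apply) auto
  finally show "(wedge_projection u * A) $$ (I, J) = A $$ (I, J)" .
qed (use A in auto)

text \<open>The columns of the matrix are themselves antisymmetric and orthogonal to
  \<open>axial_vec u\<close>, hence fixed by it.\<close>

lemma wedge_projection_idem:
  assumes "unit_vec3 u"
  shows "wedge_projection u * wedge_projection u = wedge_projection u"
proof (rule wedge_projection_fixes)
  fix I J :: nat assume IJ: "I < 9" "J < 9"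
  have "(flip I = J) = (J = flip I)" "(J = flip (flip I)) = (I = J)"
    using flip_flip[OF IJ(1)] by auto
  then show "wedge_projection u $$ (flip I, J) = - wedge_projection u $$ (I, J)"
    using IJ by (auto simp: wedge_projection_def reflection_def swap_kernel_flip flip_less axial_vec_flip field_simps)
next
  fix J :: nat assume J: "J < 9"
  let ?a = "axial_vec u"
  have "(\<Sum>K<9. cnj (?a K) * wedge_projection u $$ (K, J))
      = (\<Sum>K<9. (if K = J then cnj (?a K) else 0) - cnj (?a J) * (cnj (?a K) * ?a K)
          - (if K = flip J then cnj (?a K) else 0)) / 2"
    unfolding sum_divide_distrib
  proof (intro sum.cong refl)
    fix K :: nat assume "K \<in> {..<9}"
    then have K: "K < 9" by simp
    show "cnj (?a K) * wedge_projection u $$ (K, J) = ((if K = J then cnj (?a K) else 0)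
        - cnj (?a J) * (cnj (?a K) * ?a K) - (if K = flip J then cnj (?a K) else 0)) / 2"
      unfolding wedge_projection_def reflection_def using K J
      by (simp add: swap_kernel_flip'[OF K J] right_diff_distrib)
  qed
  also have "\<dots> = (cnj (?a J) - cnj (?a J) * (\<Sum>K<9. cnj (?a K) * ?a K) - cnj (?a (flip J))) / 2"
    using J flip_less[OF J] by (simp add: sum_subtractf sum_distrib_left)
  also have "\<dots> = 0"
    using J axial_vec_norm[OF assms] by (simp add: axial_vec_flip)
  finally show "(\<Sum>K<9. cnj (?a K) * wedge_projection u $$ (K, J)) = 0" .
qed simp

lemma wedge_projection_adjoint: "mat_adjoint (wedge_projection u) = wedge_projection u"
  by (rule eq_matI) (auto simp: wedge_projection_def reflection_def swap_kernel_def mult.commute)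

section \<open>Positivity of the partially transposed operators\<close>

definition mixed :: "nat \<Rightarrow> nat \<Rightarrow> nat" where
  "mixed I J = (I div 3) * 3 + J mod 3"

lemma mixed_div_mod [simp]: "mixed I J div 3 = I div 3" "mixed I J mod 3 = J mod 3"
  by (simp_all add: mixed_def)

definition coker :: "(nat \<Rightarrow> complex) \<Rightarrow> nat \<Rightarrow> nat \<Rightarrow> complex" where
  "coker u i k = (if i = k then 1 else 0) - u i * cnj (u k)"

text \<open>The vector behind the rank-one term of \<open>V\<^sup>\<Gamma> + 2 P\<^sup>\<Gamma> = 2
  V\<^sup>\<Gamma> - F\<^sup>\<Gamma>\<close>. For u = e_0 this operator is 2 on e_0 e_k and e_k e_0
  with k = 1, 2, it is 0 on e_1 e_2 and e_2 e_1, and on the span of the e_k e_k it is the rank-one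
  operator of the vector (1, -1, -1). The general formula restates this covariantly.\<close>

definition tau :: "(nat \<Rightarrow> complex) \<Rightarrow> nat \<Rightarrow> nat \<Rightarrow> complex" where
  "tau u i j = 2 * (u i * cnj (u j)) - (if i = j then 1 else 0)"

text \<open>The rows of the cross product matrix have the projection onto the complement of
  \<open>u\<close> as their Gram matrix; this exhibits \<open>coker u\<close> as positive.\<close>

lemma axial_gram:
  assumes "unit_vec3 u" "i < 3" "k < 3"
  shows "(\<Sum>m<3. axial u i m * cnj (axial u k m)) = coker u i k"
proof -
  define N where "N = u 0 * cnj (u 0) + u 1 * cnj (u 1) + u 2 * cnj (u 2)"
  have "(\<Sum>m<3. axial u i m * cnj (axial u k m)) = (if i = k then N else 0) - u i * cnj (u k)"
    using less_three_cases[OF assms(2)] less_three_cases[OF assms(3)]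
    by (elim disjE; simp add: sum_less_three axial_def N_def)
  moreover have "N = 1"
    using assms(1) by (simp only: N_def)
  ultimately show ?thesis
    by (simp add: coker_def)
qed

text \<open>The identity is homogenised by powers of \<open>N = 1\<close> so that it becomes a polynomial identity.\<close>

lemma reflection_identity:
  assumes "unit_vec3 u" "i < 3" "j < 3" "k < 3" "l < 3"
  shows "2 * ((if i = k then 1 else 0) * (if j = l then 1 else 0)) - 2 * (axial u i l * cnj (axial u k j))
      - (if i = j then 1 else 0) * (if k = l then 1 else 0)
    = 2 * (u i * cnj (u k) * coker u l j) + 2 * (coker u i k * (cnj (u j) * u l)) + tau u i j * cnj (tau u k l)"
proof -
  define N where "N = u 0 * cnj (u 0) + u 1 * cnj (u 1) + u 2 * cnj (u 2)"
  have "2 * ((if i = k then N else 0) * (if j = l then N else 0)) - 2 * (axial u i l * cnj (axial u k j)) * N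
      - (if i = j then N else 0) * (if k = l then N else 0)
    = 2 * (u i * cnj (u k) * ((if l = j then N else 0) - u l * cnj (u j)))
      + 2 * (((if i = k then N else 0) - u i * cnj (u k)) * (cnj (u j) * u l))
      + (2 * (u i * cnj (u j)) - (if i = j then N else 0)) * (2 * (u l * cnj (u k)) - (if k = l then N else 0))"
    using less_three_cases[OF assms(2)] less_three_cases[OF assms(3)] less_three_cases[OF assms(4)]
      less_three_cases[OF assms(5)]
    by (elim disjE; simp add: axial_def N_def algebra_simps)
  moreover have N: "N = 1"
    using assms(1) by (simp only: N_def)
  moreover have t: "cnj (tau u k l) = 2 * (u l * cnj (u k)) - (if k = l then 1 else 0)"
    by (simp add: tau_def mult.commute)
  ultimately show ?thesis
    unfolding t unfolding coker_def tau_def N by (simp only: mult_1_right)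
qed

definition phi_vec :: "nat \<Rightarrow> complex" where
  "phi_vec I = (if I div 3 = I mod 3 then 1 else 0)"

text \<open>Beyond index 2 the values of \<open>u\<close> are unconstrained and
  \<open>coker u\<close> may fail to be positive, so a Gram kernel \<open>Q\<close> that agrees with
  it on 0, 1, 2 takes its place.\<close>

lemma pos_kernel_coker:
  assumes "unit_vec3 u"
  obtains Q where "pos_kernel Q" "\<And>i k. i < 3 \<Longrightarrow> k < 3 \<Longrightarrow> Q i k = coker u i k"
  using axial_gram[OF assms]
  by (intro that[of "\<lambda>i k. \<Sum>m<3. axial u i m * cnj (axial u k m)"] pos_kernel_sum pos_kernel.rank_one) auto

text \<open>Writing \<open>P = (V - F) / 2\<close> with the reflection \<open>V\<close> and the swap \<open>F\<close>, the operators
  \<open>V\<^sup>\<Gamma> \<plusminus> 2 P\<^sup>\<Gamma>\<close> are positive, where \<open>\<Gamma>\<close> is partial transposition;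
  \<open>V\<^sup>\<Gamma> - 2 P\<^sup>\<Gamma> = F\<^sup>\<Gamma>\<close>.\<close>

lemma pos_kernel_reflection_minus:
  "pos_kernel (\<lambda>I J. reflection u (mixed I J) (mixed J I) - (reflection u (mixed I J) (mixed J I) - swap_kernel (mixed I J) (mixed J I)))"
proof -
  have "(\<lambda>I J. reflection u (mixed I J) (mixed J I) - (reflection u (mixed I J) (mixed J I) - swap_kernel (mixed I J) (mixed J I)))
      = (\<lambda>I J. phi_vec I * cnj (phi_vec J))"
    by (intro ext) (auto simp: swap_kernel_def phi_vec_def)
  then show ?thesis
    by (simp only: pos_kernel.rank_one)
qed

lemma mixed_eq_iff: "mixed I J = mixed J I \<longleftrightarrow> I = J"
  by (metis div_mult_mod_eq mixed_div_mod)

lemma pos_kernel_reflection_plus: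
  assumes u: "unit_vec3 u"
  obtains B where "pos_kernel B" "\<And>I J. I < 9 \<Longrightarrow> J < 9 \<Longrightarrow>
    B I J = reflection u (mixed I J) (mixed J I) + (reflection u (mixed I J) (mixed J I) - swap_kernel (mixed I J) (mixed J I))"
proof -
  obtain Q where Q: "pos_kernel Q" "\<And>i k. i < 3 \<Longrightarrow> k < 3 \<Longrightarrow> Q i k = coker u i k"
    using pos_kernel_coker[OF u] by blast
  let ?B = "\<lambda>I J. complex_of_real 2 * ((u (I div 3) * cnj (u (J div 3))) * cnj (Q (I mod 3) (J mod 3)))
    + complex_of_real 2 * (Q (I div 3) (J div 3) * cnj (u (I mod 3) * cnj (u (J mod 3))))
    + tau u (I div 3) (I mod 3) * cnj (tau u (J div 3) (J mod 3))"
  have p1: "pos_kernel (\<lambda>I J. (u (I div 3) * cnj (u (J div 3))) * cnj (Q (I mod 3) (J mod 3)))"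
    by (rule pos_kernel_mult[OF pos_kernel.rank_one[of "\<lambda>I. u (I div 3)"]
          pos_kernel_cnj[OF pos_kernel_comp[OF Q(1), of "\<lambda>I. I mod 3"]]])
  have p2: "pos_kernel (\<lambda>I J. Q (I div 3) (J div 3) * cnj (u (I mod 3) * cnj (u (J mod 3))))"
    by (rule pos_kernel_mult[OF pos_kernel_comp[OF Q(1), of "\<lambda>I. I div 3"]
          pos_kernel_cnj[OF pos_kernel.rank_one[of "\<lambda>I. u (I mod 3)"]]])
  have "pos_kernel ?B"
    by (rule pos_kernel.add[OF pos_kernel.add[OF pos_kernel_scale[OF p1] pos_kernel_scale[OF p2]]
          pos_kernel.rank_one[of "\<lambda>I. tau u (I div 3) (I mod 3)"]]) simp_all
  moreover have "?B I J = reflection u (mixed I J) (mixed J I)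
      + (reflection u (mixed I J) (mixed J I) - swap_kernel (mixed I J) (mixed J I))"
    if IJ: "I < 9" "J < 9" for I J
  proof -
    have lt: "I div 3 < 3" "I mod 3 < 3" "J div 3 < 3" "J mod 3 < 3"
      using IJ by auto
    have "I = J \<longleftrightarrow> I div 3 = J div 3 \<and> I mod 3 = J mod 3"
      by (metis div_mult_mod_eq)
    then have \<delta>: "(if I = J then 1 else 0 :: complex)
        = (if I div 3 = J div 3 then 1 else 0) * (if I mod 3 = J mod 3 then 1 else 0)"
      by (simp only:) simp
    have "reflection u (mixed I J) (mixed J I) + (reflection u (mixed I J) (mixed J I) - swap_kernel (mixed I J) (mixed J I))
        = 2 * (if I = J then 1 else 0) - 2 * (axial u (I div 3) (J mod 3) * cnj (axial u (J div 3) (I mod 3)))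
          - (if I div 3 = I mod 3 then 1 else 0) * (if J div 3 = J mod 3 then 1 else 0)"
      unfolding reflection_def swap_kernel_def axial_vec_def mixed_eq_iff mixed_div_mod by simp
    also have "\<dots> = 2 * (u (I div 3) * cnj (u (J div 3)) * coker u (J mod 3) (I mod 3))
        + 2 * (coker u (I div 3) (J div 3) * (cnj (u (I mod 3)) * u (J mod 3)))
        + tau u (I div 3) (I mod 3) * cnj (tau u (J div 3) (J mod 3))"
      unfolding \<delta> by (rule reflection_identity[OF u lt(1,2,3,4)])
    also have "coker u (J mod 3) (I mod 3) = cnj (Q (I mod 3) (J mod 3))"
      unfolding Q(2)[OF lt(2,4)] by (simp add: coker_def mult.commute)
    also have "coker u (I div 3) (J div 3) = Q (I div 3) (J div 3)"
      by (rule Q(2)[OF lt(1,3), symmetric])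
    finally show ?thesis
      by simp
  qed
  ultimately show ?thesis
    using that by blast
qed

text \<open>As \<open>axial_vec u\<close> has squared norm 2, \<open>?r\<close> is the projection
  onto its orthogonal complement and 1 + V is twice this projection; a projection is the Gram kernel
  of its own rows.\<close>

lemma pos_kernel_one_plus_reflection:
  assumes u: "unit_vec3 u"
  obtains B where "pos_kernel B" "\<And>I J. I < 9 \<Longrightarrow> J < 9 \<Longrightarrow>
    B I J = (if I = J then 1 else 0) + reflection u I J"
proof -
  let ?a = "axial_vec u"
  let ?r = "\<lambda>I M. (if M = I then 1 else 0) - ?a I * cnj (?a M) / 2"
  have "(\<Sum>M<9. ?r I M * cnj (?r J M)) = (if I = J then 1 else 0) - ?a I * cnj (?a J) / 2"
    if IJ: "I < 9" "J < 9" for I J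
  proof -
    have "(\<Sum>M<9. ?r I M * cnj (?r J M)) = (\<Sum>M<9. (if M = I then if I = J then 1 else 0 else 0)
        - (if M = I then cnj (?a J) * ?a M / 2 else 0) - (if M = J then ?a I * cnj (?a M) / 2 else 0)
        + ?a I * cnj (?a J) / 4 * (cnj (?a M) * ?a M))"
    proof (intro sum.cong refl)
      fix M
      show "?r I M * cnj (?r J M) = (if M = I then if I = J then 1 else 0 else 0)
          - (if M = I then cnj (?a J) * ?a M / 2 else 0) - (if M = J then ?a I * cnj (?a M) / 2 else 0)
          + ?a I * cnj (?a J) / 4 * (cnj (?a M) * ?a M)"
        by (cases "M = I"; cases "M = J"; simp add: field_simps)
    qed
    also have "\<dots> = (if I = J then 1 else 0) - cnj (?a J) * ?a I / 2 - ?a I * cnj (?a J) / 2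
        + ?a I * cnj (?a J) / 4 * (\<Sum>M<9. cnj (?a M) * ?a M)"
      using IJ by (simp add: sum.distrib sum_subtractf sum_distrib_left)
    finally show ?thesis
      unfolding axial_vec_norm[OF u] by simp
  qed
  then show ?thesis
    by (intro that[of "\<lambda>I J. complex_of_real 2 * (\<Sum>M<9. ?r I M * cnj (?r J M))"]
        pos_kernel_scale pos_kernel_sum pos_kernel.rank_one[of "\<lambda>I. ?r I _"])
      (simp_all add: reflection_def)
qed

lemma prod_of_bool_eq:
  "finite S \<Longrightarrow> (\<Prod>k\<in>S. if P k then 1 else 0 :: complex) = (if \<forall>k\<in>S. P k then 1 else 0)"
  by (induction S rule: finite_induct) auto

text \<open>Let \<open>v\<close> and \<open>w\<close> be the partial transposes of V and 2 P. With
  tensor powers understood, \<open>2 ^ n Tr (P \<sigma>) = Tr (w \<sigma>\<^sup>\<Gamma>) \<le> Tr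
  (v \<sigma>\<^sup>\<Gamma>) = Tr (V \<sigma>) \<le> Tr \<sigma>\<close>. The first inequality
  rests on the PPT property, the second on positivity of \<open>\<sigma>\<close>.\<close>

lemma wedge_projection_overlap:
  assumes u: "unit_vec3 u" and \<sigma>: "density_op (3 ^ n * 3 ^ n) \<sigma>"
    and ppt: "psd (3 ^ n * 3 ^ n) (partial_transpose (3 ^ n) (3 ^ n) \<sigma>)"
  shows "Re (mtrace (tensor_power 3 3 n (wedge_projection u) * \<sigma>)) \<le> (1 / 2) ^ n"
proof -
  let ?N = "3 ^ n * 3 ^ n :: nat" and ?c = "copy_index 3 3 n"
  let ?P = "wedge_projection u" and ?pt = "partial_transpose (3 ^ n) (3 ^ n)"
  have \<sigma>psd: "psd ?N \<sigma>" and tr: "mtrace \<sigma> = 1"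
    using \<sigma> by (auto simp: density_op_def)
  have car: "\<sigma> \<in> carrier_mat ?N ?N"
    using \<sigma>psd by (auto simp: psd_def)
  have c9: "?c k I < 9" for k I
    using copy_index_less[of 3 3 n k I] by simp
  define V where "V = mat 9 9 (\<lambda>(I, J). reflection u I J)"
  define v where "v I J = reflection u (mixed I J) (mixed J I)" for I J
  define w where "w I J = reflection u (mixed I J) (mixed J I) - swap_kernel (mixed I J) (mixed J I)" for I J
  have mixed9: "mixed I J < 9" if "I < 9" for I J
    using mixed_index_less[of I 3 3 J] that by (simp add: mixed_def)
  have pt: "?pt (tensor_power 3 3 n A) $$ (I, J) = (\<Prod>k<n. partial_transpose 3 3 A $$ (?c k I, ?c k J))"
    if "I < ?N" "J < ?N" for A :: "complex mat" and I J
    by (subst partial_transpose_tensor_power) (simp_all add: index_tensor_power that)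
  have ptw: "partial_transpose 3 3 ?P $$ (I, J) = (1 / 2) * w I J" if "I < 9" "J < 9" for I J
    using that mixed9[of I J] mixed9[of J I]
    by (simp add: index_partial_transpose mixed_def[symmetric] wedge_projection_def w_def)
  have ptP: "?pt (tensor_power 3 3 n ?P) $$ (I, J) = (1 / 2) ^ n * (\<Prod>k<n. w (?c k I) (?c k J))"
    if "I < ?N" "J < ?N" for I J
    by (simp only: pt[OF that] ptw[OF c9 c9] prod.distrib prod_constant card_lessThan)
  have "partial_transpose 3 3 V $$ (I, J) = v I J" if "I < 9" "J < 9" for I J
    using that mixed9[of I J] mixed9[of J I]
    by (simp add: index_partial_transpose mixed_def[symmetric] V_def v_def)
  then have ptV: "?pt (tensor_power 3 3 n V) $$ (I, J) = (\<Prod>k<n. v (?c k I) (?c k J))"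
    if "I < ?N" "J < ?N" for I J
    by (simp add: pt[OF that] c9)
  obtain B where B: "pos_kernel B" "\<And>I J. I < 9 \<Longrightarrow> J < 9 \<Longrightarrow> B I J = v I J + w I J"
    using pos_kernel_reflection_plus[OF u] unfolding v_def w_def by blast
  have "pos_kernel (\<lambda>I J. v (?c k I) (?c k J) - w (?c k I) (?c k J))" for k
    using pos_kernel_comp[OF pos_kernel_reflection_minus[of u], of "?c k"] by (simp add: v_def w_def)
  moreover have "pos_kernel (\<lambda>I J. v (?c k I) (?c k J) + w (?c k I) (?c k J))" for k
    using pos_kernel_comp[OF B(1), of "?c k"] by (simp add: B(2) c9)
  ultimately have "pos_kernel (\<lambda>I J. (\<Prod>k<n. v (?c k I) (?c k J)) - (\<Prod>k<n. w (?c k I) (?c k J)))"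
    by (intro pos_kernel_prod_diff_add[THEN conjunct1]) auto
  from pos_kernel_trace_nonneg[OF this ppt]
  have 1: "(\<Sum>I<?N. \<Sum>J<?N. (\<Prod>k<n. w (?c k I) (?c k J)) * ?pt \<sigma> $$ (J, I))
      \<le> (\<Sum>I<?N. \<Sum>J<?N. (\<Prod>k<n. v (?c k I) (?c k J)) * ?pt \<sigma> $$ (J, I))"
    by (simp add: left_diff_distrib sum_subtractf)
  have 2: "mtrace (tensor_power 3 3 n ?P * \<sigma>)
      = (1 / 2) ^ n * (\<Sum>I<?N. \<Sum>J<?N. (\<Prod>k<n. w (?c k I) (?c k J)) * ?pt \<sigma> $$ (J, I))"
    unfolding mtrace_mult_sum[OF tensor_power_carrier car]
    by (subst trace_partial_transpose[symmetric]) (auto simp: ptP sum_distrib_left mult.assoc)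
  have 3: "(\<Sum>I<?N. \<Sum>J<?N. (\<Prod>k<n. v (?c k I) (?c k J)) * ?pt \<sigma> $$ (J, I))
      = (\<Sum>I<?N. \<Sum>J<?N. (\<Prod>k<n. reflection u (?c k I) (?c k J)) * \<sigma> $$ (J, I))"
  proof -
    have "(\<Sum>I<?N. \<Sum>J<?N. (\<Prod>k<n. v (?c k I) (?c k J)) * ?pt \<sigma> $$ (J, I))
        = (\<Sum>I<?N. \<Sum>J<?N. ?pt (tensor_power 3 3 n V) $$ (I, J) * ?pt \<sigma> $$ (J, I))"
      by (simp add: ptV)
    also have "\<dots> = (\<Sum>I<?N. \<Sum>J<?N. tensor_power 3 3 n V $$ (I, J) * \<sigma> $$ (J, I))"
      by (rule trace_partial_transpose) simp
    finally show ?thesis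
      by (simp add: index_tensor_power V_def c9)
  qed
  \<comment> \<open>Second use of the product lemma, now for the pair 1 and V: from -1 \<le> V \<le>
    1 it follows that the tensor power of V is at most 1.\<close>
  obtain B' where B': "pos_kernel B'" "\<And>I J. I < 9 \<Longrightarrow> J < 9 \<Longrightarrow> B' I J = (if I = J then 1 else 0) + reflection u I J"
    using pos_kernel_one_plus_reflection[OF u] by blast
  have "pos_kernel (\<lambda>I J. (if ?c k I = ?c k J then 1 else 0) - reflection u (?c k I) (?c k J))" for k
    using pos_kernel.rank_one[of "\<lambda>I. axial_vec u (?c k I)"] by (simp add: reflection_def)
  moreover have "pos_kernel (\<lambda>I J. (if ?c k I = ?c k J then 1 else 0) + reflection u (?c k I) (?c k J))" for k
    using pos_kernel_comp[OF B'(1), of "?c k"] by (simp add: B'(2) c9)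
  ultimately have "pos_kernel (\<lambda>I J. (\<Prod>k<n. if ?c k I = ?c k J then 1 else 0) - (\<Prod>k<n. reflection u (?c k I) (?c k J)))"
    by (intro pos_kernel_prod_diff_add[THEN conjunct1]) auto
  from pos_kernel_trace_nonneg[OF this \<sigma>psd]
  have "(\<Sum>I<?N. \<Sum>J<?N. (\<Prod>k<n. reflection u (?c k I) (?c k J)) * \<sigma> $$ (J, I))
      \<le> (\<Sum>I<?N. \<Sum>J<?N. (\<Prod>k<n. if ?c k I = ?c k J then 1 else 0) * \<sigma> $$ (J, I))"
    by (simp add: left_diff_distrib sum_subtractf)
  \<comment> \<open>The copy indices determine the joint index, so the product of Kronecker deltas
    is the delta of joint indices.\<close>
  also have "\<dots> = (\<Sum>I<?N. \<Sum>J<?N. if J = I then \<sigma> $$ (J, I) else 0)"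
  proof (intro sum.cong refl)
    fix I J assume "I \<in> {..<?N}" "J \<in> {..<?N}"
    then have "(\<forall>k\<in>{..<n}. ?c k I = ?c k J) \<longleftrightarrow> J = I"
      using copy_index_inject[of 3 I 3 n J] by auto
    then show "(\<Prod>k<n. if ?c k I = ?c k J then 1 else 0) * \<sigma> $$ (J, I) = (if J = I then \<sigma> $$ (J, I) else 0)"
      by (simp add: prod_of_bool_eq)
  qed
  also have "\<dots> = 1"
    using tr car by (simp add: mtrace_sum[of _ ?N])
  finally have "(\<Sum>I<?N. \<Sum>J<?N. (\<Prod>k<n. w (?c k I) (?c k J)) * ?pt \<sigma> $$ (J, I)) \<le> 1"
    using 1 3 by simp
  then have *: "Re (\<Sum>I<?N. \<Sum>J<?N. (\<Prod>k<n. w (?c k I) (?c k J)) * ?pt \<sigma> $$ (J, I)) \<le> 1"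
    by (simp add: less_eq_complex_def)
  have half: "((1 / 2) ^ n :: complex) = complex_of_real ((1 / 2) ^ n)"
    by simp
  have "Re (mtrace (tensor_power 3 3 n ?P * \<sigma>))
      = (1 / 2) ^ n * Re (\<Sum>I<?N. \<Sum>J<?N. (\<Prod>k<n. w (?c k I) (?c k J)) * ?pt \<sigma> $$ (J, I))"
    unfolding 2 half times_complex.sel Re_complex_of_real Im_complex_of_real by simp
  then show ?thesis
    using * by (simp add: mult_left_le)
qed


section \<open>Antisymmetric vectors and states in coordinates\<close>

lemma swap_op_index: "I < 9 \<Longrightarrow> J < 9 \<Longrightarrow> swap_op 3 $$ (I, J) = swap_kernel I J"
  by (simp add: swap_op_def swap_kernel_def)

text \<open>Each column of \<open>A\<close> is the image of a basis vector and so lies in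
  \<open>mat_supp A\<close>.\<close>

lemma antisym_support_entries:
  assumes A: "A \<in> carrier_mat 9 9" and supp: "mat_supp A \<subseteq> antisym_space 3" and IJ: "I < 9" "J < 9"
  shows "A $$ (flip I, J) = - A $$ (I, J)"
proof -
  have "A *\<^sub>v unit_vec 9 J \<in> mat_supp A"
    unfolding mat_supp_def using A by (intro CollectI exI[of _ "unit_vec 9 J"]) simp
  then have "A *\<^sub>v unit_vec 9 J \<in> antisym_space 3"
    using supp by blast
  moreover have "A *\<^sub>v unit_vec 9 J = col A J"
    using A IJ by (intro eq_vecI) (auto simp: scalar_prod_right_unit)
  ultimately have "swap_op 3 *\<^sub>v col A J = - col A J"
    by (simp add: antisym_space_def)
  then have "(swap_op 3 *\<^sub>v col A J) $ I = - A $$ (I, J)"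
    using A IJ by simp
  moreover have "(swap_op 3 *\<^sub>v col A J) $ I = (\<Sum>K<9. swap_kernel I K * A $$ (K, J))"
    using A IJ by (subst index_mult_mat_vec_sum) (auto simp: swap_op_index, simp_all add: swap_op_def)
  ultimately show ?thesis
    using IJ by (simp add: swap_kernel_apply)
qed

lemma flip_values:
  "flip 0 = 0" "flip 1 = 3" "flip 2 = 6" "flip 3 = 1" "flip 4 = 4" "flip 5 = 7" "flip 6 = 2" "flip 7 = 5" "flip 8 = 8"
  by (simp_all add: flip_def)

lemma antisym_values:
  fixes h :: "nat \<Rightarrow> complex"
  assumes "\<And>I. I < 9 \<Longrightarrow> h (flip I) = - h I"
  shows "h 0 = 0" "h 4 = 0" "h 8 = 0" "h 3 = - h 1" "h 6 = - h 2" "h 7 = - h 5"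
  using assms[of 0] assms[of 4] assms[of 8] assms[of 1] assms[of 2] assms[of 5]
  by (simp_all only: flip_values) simp_all

text \<open>Entries 1, 2, 5 belong to the pairs (0,1), (0,2), (1,2) and determine an antisymmetric
  vector; each occurs twice up to sign, whence the factor 2.\<close>

lemma axial_vec_orthogonal:
  fixes h :: "nat \<Rightarrow> complex"
  assumes "\<And>I. I < 9 \<Longrightarrow> h (flip I) = - h I"
  shows "(\<Sum>K<9. cnj (axial_vec u K) * h K) = 2 * (u 2 * h 1 - u 1 * h 2 + u 0 * h 5)"
  using antisym_values[of h, OF assms] arg_cong[OF numeral_2_eq_2, of h]
  by (simp add: sum_less_nine sum_less_three axial_vec_def axial_def algebra_simps)

text \<open>Every antisymmetric \<open>h\<close> is the wedge of \<open>u\<close> with its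
  contraction by the conjugate of \<open>u\<close>, plus a multiple \<open>Q\<close> of
  \<open>axial_vec u\<close>; orthogonality kills \<open>Q\<close>.\<close>

lemma wedge_decomposition:
  fixes h :: "nat \<Rightarrow> complex"
  assumes u: "unit_vec3 u" and anti: "\<And>I. I < 9 \<Longrightarrow> h (flip I) = - h I"
    and orth: "(\<Sum>K<9. cnj (axial_vec u K) * h K) = 0" and ij: "i < 3" "j < 3"
  shows "h (3 * i + j) = u i * (\<Sum>m<3. cnj (u m) * h (3 * m + j)) - u j * (\<Sum>m<3. cnj (u m) * h (3 * m + i))"
proof -
  define N where "N = u 0 * cnj (u 0) + u 1 * cnj (u 1) + u 2 * cnj (u 2)"
  define Q where "Q = u 2 * h 1 - u 1 * h 2 + u 0 * h 5"
  have "u i * (\<Sum>m<3. cnj (u m) * h (3 * m + j)) - u j * (\<Sum>m<3. cnj (u m) * h (3 * m + i))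
      = N * h (3 * i + j) - axial u i j * Q"
    using less_three_cases[OF ij(1)] less_three_cases[OF ij(2)] antisym_values[of h, OF anti]
      arg_cong[OF numeral_2_eq_2, of h]
    by (elim disjE; simp add: sum_less_three axial_def N_def Q_def algebra_simps)
  moreover have "N = 1"
    using u by (simp only: N_def)
  moreover have "Q = 0"
    using orth axial_vec_orthogonal[of h u, OF anti] unfolding Q_def[symmetric] by simp
  ultimately show ?thesis
    by simp
qed

text \<open>The antisymmetric subspace has dimension 3, so rank 2 leaves a nonzero antisymmetric
  vector orthogonal to the range, and each such vector is a multiple of some
  \<open>axial_vec u\<close>.\<close>

lemma exists_orthogonal_axial:
  assumes A: "psd 9 A" and rank: "vec_space.rank 9 A = 2"
    and anti: "\<And>I J. I < 9 \<Longrightarrow> J < 9 \<Longrightarrow> A $$ (flip I, J) = - A $$ (I, J)"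
  obtains u where "unit_vec3 u" "\<And>J. J < 9 \<Longrightarrow> (\<Sum>K<9. cnj (axial_vec u K) * A $$ (K, J)) = 0"
proof -
  have car: "A \<in> carrier_mat 9 9"
    using A by (simp add: psd_def)
  \<comment> \<open>The positions of (0,1), (0,2), (1,2), the free coordinates of an antisymmetric
    vector. A 3 x 3 minor must vanish at rank 2.\<close>
  let ?I = "{1, 2, 5} :: nat set"
  let ?S = "submatrix A ?I ?I"
  have "{i. i < 9 \<and> i \<in> ?I} = ?I"
    by auto
  then have card: "card {i. i < 9 \<and> i \<in> ?I} = 3"
    by simp
  have S: "?S \<in> carrier_mat 3 3"
    by (rule carrier_matI) (use car card in \<open>simp_all only: dim_submatrix carrier_matD\<close>)
  have "det ?S = 0"
    using vec_space.rank_gt_minor[OF car, of ?I ?I] card rank by (cases "det ?S = 0") auto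
  then have "\<exists>y. y \<in> carrier_vec 3 \<and> y \<noteq> 0\<^sub>v 3 \<and> ?S *\<^sub>v y = 0\<^sub>v 3"
    by (simp only: det_0_iff_vec_prod_zero[OF S] simp_thms)
  then obtain y where y: "y \<in> carrier_vec 3" "y \<noteq> 0\<^sub>v 3" "?S *\<^sub>v y = 0\<^sub>v 3"
    by (elim exE conjE)
  have below: "{a \<in> ?I. a < 1} = {}" "{a \<in> ?I. a < 2} = {1}" "{a \<in> ?I. a < 5} = {1, 2}"
    by auto
  have ent: "?S $$ (card {a \<in> ?I. a < i}, card {a \<in> ?I. a < j}) = A $$ (i, j)" if "i \<in> ?I" "j \<in> ?I" for i j
    using that car by (intro submatrix_index_card) auto
  have row: "A $$ (r, 1) * y $ 0 + A $$ (r, 2) * y $ 1 + A $$ (r, 5) * y $ 2 = 0" if r: "r \<in> ?I" for r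
  proof -
    have "r = 1 \<or> r = 2 \<or> r = 5"
      using r by simp
    then have k: "card {a \<in> ?I. a < r} < 3"
      by (elim disjE) (simp_all only: below, simp_all)
    have "(?S *\<^sub>v y) $ card {a \<in> ?I. a < r} = (\<Sum>m<3. ?S $$ (card {a \<in> ?I. a < r}, m) * y $ m)"
      using S y(1) k by (subst index_mult_mat_vec_sum) auto
    moreover have "(?S *\<^sub>v y) $ card {a \<in> ?I. a < r} = 0"
      using k by (simp only: y(3) index_zero_vec)
    moreover have "?S $$ (card {a \<in> ?I. a < r}, 0) = A $$ (r, 1)" "?S $$ (card {a \<in> ?I. a < r}, 1) = A $$ (r, 2)"
      "?S $$ (card {a \<in> ?I. a < r}, 2) = A $$ (r, 5)"
      using ent[OF r, of 1] ent[OF r, of 2] ent[OF r, of 5] unfolding below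
      by (simp_all add: card_insert_if numeral_2_eq_2)
    ultimately show ?thesis
      by (simp only: sum_less_three)
  qed
  \<comment> \<open>Hermiticity turns the kernel vector of the minor into a relation between rows 1,
    2, 5, valid in columns 1, 2, 5; antisymmetry in the column index extends it to all
    columns.\<close>
  have col: "cnj (y $ 0) * A $$ (1, r) + cnj (y $ 1) * A $$ (2, r) + cnj (y $ 2) * A $$ (5, r) = 0" if r: "r < 9" for r
  proof -
    have base: "cnj (y $ 0) * A $$ (1, r) + cnj (y $ 1) * A $$ (2, r) + cnj (y $ 2) * A $$ (5, r) = 0" if "r \<in> ?I" for r
    proof -
      have "A $$ (1, r) = cnj (A $$ (r, 1))" "A $$ (2, r) = cnj (A $$ (r, 2))" "A $$ (5, r) = cnj (A $$ (r, 5))"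
        by (rule psd_hermitian_entry[OF A]; use that in auto)+
      then show ?thesis
        using arg_cong[OF row[OF that], of cnj] by (simp add: mult.commute)
    qed
    have anti': "A $$ (K, flip J) = - A $$ (K, J)" if "K < 9" "J < 9" for K J
      using psd_hermitian_entry[OF A, of "flip J" K] psd_hermitian_entry[OF A, of J K] anti[of J K] that flip_less[of J] by simp
    define F where "F r = cnj (y $ 0) * A $$ (1, r) + cnj (y $ 1) * A $$ (2, r) + cnj (y $ 2) * A $$ (5, r)" for r
    have F: "F (flip J) = - F J" if "J < 9" for J
      using that by (simp add: F_def anti')
    have "F 1 = 0" "F 2 = 0" "F 5 = 0"
      unfolding F_def by (intro base; simp)+
    moreover have "r = 0 \<or> r = 1 \<or> r = 2 \<or> r = 3 \<or> r = 4 \<or> r = 5 \<or> r = 6 \<or> r = 7 \<or> r = 8"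
      using r by auto
    ultimately have "F r = 0"
      using antisym_values[of F, OF F] by auto
    then show ?thesis
      by (simp only: F_def)
  qed
  define t where "t = sqrt ((cmod (y $ 0))\<^sup>2 + (cmod (y $ 1))\<^sup>2 + (cmod (y $ 2))\<^sup>2)"
  have "y $ 0 \<noteq> 0 \<or> y $ 1 \<noteq> 0 \<or> y $ 2 \<noteq> 0"
  proof (rule ccontr)
    assume "\<not> (y $ 0 \<noteq> 0 \<or> y $ 1 \<noteq> 0 \<or> y $ 2 \<noteq> 0)"
    then have "y = 0\<^sub>v 3"
      using y(1) by (intro eq_vecI) (auto dest!: less_three_cases)
    then show False
      using y(2) by simp
  qed
  then have "0 < (cmod (y $ 0))\<^sup>2 + (cmod (y $ 1))\<^sup>2 + (cmod (y $ 2))\<^sup>2"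
    by (elim disjE) (simp_all add: add_pos_nonneg add_nonneg_pos)
  then have t: "0 < t" "t\<^sup>2 = (cmod (y $ 0))\<^sup>2 + (cmod (y $ 1))\<^sup>2 + (cmod (y $ 2))\<^sup>2"
    by (auto simp: t_def)
  \<comment> \<open>Chosen so that the coefficients \<open>u 2\<close>, \<open>- u 1\<close>,
    \<open>u 0\<close> of \<open>axial_vec_orthogonal\<close> are the conjugated entries of
    \<open>y\<close>, normalised by \<open>t\<close>.\<close>
  define u where "u m = (if m = 0 then cnj (y $ 2) else if m = 1 then - cnj (y $ 1) else cnj (y $ 0)) / complex_of_real t"
    for m :: nat
  have "u 0 * cnj (u 0) + u 1 * cnj (u 1) + u 2 * cnj (u 2)
      = (y $ 0 * cnj (y $ 0) + y $ 1 * cnj (y $ 1) + y $ 2 * cnj (y $ 2)) / complex_of_real (t\<^sup>2)"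
    by (simp add: u_def power2_eq_square add_divide_distrib mult.commute)
  also have "y $ 0 * cnj (y $ 0) + y $ 1 * cnj (y $ 1) + y $ 2 * cnj (y $ 2) = complex_of_real (t\<^sup>2)"
    unfolding t(2) of_real_add complex_norm_square ..
  finally have unit: "unit_vec3 u"
    using t(1) by simp
  have "(\<Sum>K<9. cnj (axial_vec u K) * A $$ (K, J)) = 0" if J: "J < 9" for J
  proof -
    have "(\<Sum>K<9. cnj (axial_vec u K) * A $$ (K, J)) = 2 * (u 2 * A $$ (1, J) - u 1 * A $$ (2, J) + u 0 * A $$ (5, J))"
      using anti J by (intro axial_vec_orthogonal[of "\<lambda>K. A $$ (K, J)"]) auto
    also have "u 2 * A $$ (1, J) - u 1 * A $$ (2, J) + u 0 * A $$ (5, J)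
        = (cnj (y $ 0) * A $$ (1, J) + cnj (y $ 1) * A $$ (2, J) + cnj (y $ 2) * A $$ (5, J)) / complex_of_real t"
      by (simp add: u_def add_divide_distrib)
    also have "\<dots> = 0"
      by (simp only: col[OF J] div_0)
    finally show ?thesis
      by (simp only: mult_zero_right)
  qed
  with unit show ?thesis
    using that by blast
qed

text \<open>With eigenvalues \<open>d k \<ge> 0\<close> of sum \<open>S\<close>, the hypothesis says
  that the sum of \<open>d k * (S - d k)\<close> is at most 0. All these terms are nonnegative, so
  each \<open>d k\<close> is 0 or \<open>S\<close>, and at most one is nonzero.\<close>

lemma psd_rank_one_of_frobenius:
  assumes A: "psd n A" and le: "(Re (mtrace A))\<^sup>2 \<le> (\<Sum>i<n. \<Sum>j<n. (cmod (A $$ (i, j)))\<^sup>2)"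
  obtains y where "\<And>i j. i < n \<Longrightarrow> j < n \<Longrightarrow> A $$ (i, j) = y i * cnj (y j)"
proof -
  have car: "A \<in> carrier_mat n n"
    using A by (simp add: psd_def)
  obtain U d where U: "unitary n U" and AU: "A = U * mat_diag n (\<lambda>i. complex_of_real (d i)) * mat_adjoint U"
    and d: "\<And>i. i < n \<Longrightarrow> 0 \<le> d i"
    using psd_spectral[OF A] by blast
  define S where "S = (\<Sum>k<n. d k)"
  have tr: "Re (mtrace A) = S"
    unfolding AU mtrace_spectral[OF U] by (simp add: S_def)
  have "complex_of_real (\<Sum>i<n. \<Sum>j<n. (cmod (A $$ (i, j)))\<^sup>2) = mtrace (A * A)"
    unfolding mtrace_mult_sum[OF car car] of_real_sum complex_norm_square
    by (intro sum.cong refl) (simp add: psd_hermitian_entry[OF A, symmetric])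
  also have "\<dots> = complex_of_real (\<Sum>k<n. (d k)\<^sup>2)"
    unfolding AU spectral_mult[OF U] mtrace_spectral[OF U] by (simp add: power2_eq_square)
  finally have fro: "(\<Sum>i<n. \<Sum>j<n. (cmod (A $$ (i, j)))\<^sup>2) = (\<Sum>k<n. (d k)\<^sup>2)"
    by (simp only: of_real_eq_iff)
  have le': "d k \<le> S" if "k < n" for k
    unfolding S_def using that d by (intro member_le_sum) auto
  have "(\<Sum>k<n. d k * (S - d k)) = S\<^sup>2 - (\<Sum>k<n. (d k)\<^sup>2)"
    by (simp add: right_diff_distrib sum_subtractf S_def power2_eq_square sum_distrib_right)
  also have "\<dots> \<le> 0"
    using le unfolding tr fro by simp
  finally have "(\<Sum>k<n. d k * (S - d k)) = 0"
    using d le' by (intro antisym sum_nonneg) auto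
  then have zero: "d k = 0 \<or> d k = S" if "k < n" for k
    using that d le' by (subst (asm) sum_nonneg_eq_0_iff) auto
  have ent: "A $$ (i, j) = (\<Sum>k<n. U $$ (i, k) * d k * cnj (U $$ (j, k)))" if "i < n" "j < n" for i j
    unfolding AU by (rule spectral_entry[OF unitaryD(1)[OF U] that])
  show ?thesis
  proof (cases "\<exists>m<n. d m \<noteq> 0")
    case True
    then obtain m where m: "m < n" "d m \<noteq> 0" by blast
    then have "d m = S"
      using zero by blast
    then have "(\<Sum>k\<in>{..<n} - {m}. d k) = 0"
      using m by (simp add: S_def sum.remove)
    then have others: "d k = 0" if "k < n" "k \<noteq> m" for k
      using that d by (subst (asm) sum_nonneg_eq_0_iff) auto
    show ?thesis
    proof
      fix i j assume ij: "i < n" "j < n"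
      have "A $$ (i, j) = (\<Sum>k<n. if k = m then U $$ (i, k) * d k * cnj (U $$ (j, k)) else 0)"
        unfolding ent[OF ij] using others by (intro sum.cong) auto
      also have "\<dots> = U $$ (i, m) * complex_of_real (sqrt (d m) * sqrt (d m)) * cnj (U $$ (j, m))"
        using m d by simp
      also have "\<dots> = (complex_of_real (sqrt (d m)) * U $$ (i, m)) * cnj (complex_of_real (sqrt (d m)) * U $$ (j, m))"
        unfolding of_real_mult by simp
      finally show "A $$ (i, j) = (\<lambda>i. complex_of_real (sqrt (d m)) * U $$ (i, m)) i
          * cnj ((\<lambda>i. complex_of_real (sqrt (d m)) * U $$ (i, m)) j)" .
    qed
  next
    case False
    then show ?thesis
      by (intro that[of "\<lambda>_. 0"]) (simp add: ent)
  qed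
qed

text \<open>Compression of the first tensor factor by \<open>u\<close> sends rank-one kernels to
  rank-one kernels.\<close>

lemma pos_kernel_contract:
  fixes K :: "nat \<Rightarrow> nat \<Rightarrow> complex"
  assumes "pos_kernel K"
  shows "pos_kernel (\<lambda>j l. \<Sum>k<3. \<Sum>i<3. cnj (u i) * K (3 * i + j) (3 * k + l) * u k)"
  using assms
proof (induction rule: pos_kernel.induct)
  case (rank_one g)
  have "(\<lambda>j l. \<Sum>k<3. \<Sum>i<3. cnj (u i) * (g (3 * i + j) * cnj (g (3 * k + l))) * u k)
      = (\<lambda>j l. (\<Sum>i<3. cnj (u i) * g (3 * i + j)) * cnj (\<Sum>i<3. cnj (u i) * g (3 * i + l)))"
    by (intro ext) (simp add: sum_less_three algebra_simps)
  then show ?case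
    by (simp only: pos_kernel.rank_one)
next
  case (add K L)
  have "(\<lambda>j l. \<Sum>k<3. \<Sum>i<3. cnj (u i) * (K (3 * i + j) (3 * k + l) + L (3 * i + j) (3 * k + l)) * u k)
    = (\<lambda>j l. (\<Sum>k<3. \<Sum>i<3. cnj (u i) * K (3 * i + j) (3 * k + l) * u k)
        + (\<Sum>k<3. \<Sum>i<3. cnj (u i) * L (3 * i + j) (3 * k + l) * u k))"
    by (intro ext) (simp only: distrib_left distrib_right sum.distrib)
  then show ?case
    using pos_kernel.add[OF add.IH] by (simp only:)
qed


text \<open>The matrix \<open>R\<close> is the state on \<open>u\<^sup>\<bottom>\<close> (up to a factor 2) obtained by contracting one side
  with \<open>u\<close>, using the isometry \<open>x \<mapsto> u \<and> x\<close>.\<close>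

lemma wedge_state_decomposition:
  assumes A: "psd 9 A" and u: "unit_vec3 u"
    and anti: "\<And>I J. I < 9 \<Longrightarrow> J < 9 \<Longrightarrow> A $$ (flip I, J) = - A $$ (I, J)"
    and orth: "\<And>J. J < 9 \<Longrightarrow> (\<Sum>K<9. cnj (axial_vec u K) * A $$ (K, J)) = 0"
  obtains R where "pos_kernel R" "\<And>l. l < 3 \<Longrightarrow> (\<Sum>j<3. cnj (u j) * R j l) = 0"
    "\<And>i j k l. i < 3 \<Longrightarrow> j < 3 \<Longrightarrow> k < 3 \<Longrightarrow> l < 3 \<Longrightarrow> A $$ (3 * i + j, 3 * k + l)
      = u i * (cnj (u k) * R j l - cnj (u l) * R j k) - u j * (cnj (u k) * R i l - cnj (u l) * R i k)"
proof -
  obtain K where K: "pos_kernel K" "\<And>i j. i < 9 \<Longrightarrow> j < 9 \<Longrightarrow> A $$ (i, j) = K i j"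
    using pos_kernel_of_psd[OF A] by blast
  define R where "R j l = (\<Sum>k<3. \<Sum>i<3. cnj (u i) * K (3 * i + j) (3 * k + l) * u k)" for j l
  define X where "X j J = (\<Sum>m<3. cnj (u m) * A $$ (3 * m + j, J))" for j J
  have R: "R j l = (\<Sum>k<3. X j (3 * k + l) * u k)" if "j < 3" "l < 3" for j l
    using that by (simp add: R_def X_def K(2) sum_distrib_right)
  have col: "A $$ (3 * i + j, J) = u i * X j J - u j * X i J" if "i < 3" "j < 3" "J < 9" for i j J
    using wedge_decomposition[OF u, of "\<lambda>K. A $$ (K, J)" i j] anti orth that by (simp add: X_def)
  have herm: "A $$ (I, J) = cnj (A $$ (J, I))" if "I < 9" "J < 9" for I J
    using psd_hermitian_entry[OF A that(2,1)] .
  have anti': "A $$ (I, flip J) = - A $$ (I, J)" if "I < 9" "J < 9" for I J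
    unfolding herm[OF that] herm[OF that(1) flip_less[OF that(2)]] anti[OF that(2,1)] by simp
  have orth': "(\<Sum>J<9. axial_vec u J * A $$ (I, J)) = 0" if I: "I < 9" for I
  proof -
    have "(\<Sum>J<9. axial_vec u J * A $$ (I, J)) = cnj (\<Sum>J<9. cnj (axial_vec u J) * A $$ (J, I))"
      unfolding cnj_sum using herm[OF I] by (intro sum.cong refl) simp
    then show ?thesis
      using orth[OF I] by simp
  qed
  have Xanti: "X j (flip J) = - X j J" if "j < 3" "J < 9" for j J
    using that by (simp add: X_def anti' sum_negf)
  have Xorth: "(\<Sum>J<9. axial_vec u J * X j J) = 0" if "j < 3" for j
  proof -
    have "(\<Sum>J<9. axial_vec u J * X j J) = (\<Sum>m<3. cnj (u m) * (\<Sum>J<9. axial_vec u J * A $$ (3 * m + j, J)))"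
      unfolding X_def sum_distrib_left by (subst sum.swap) (simp add: mult_ac)
    then show ?thesis
      using that by (simp add: orth')
  qed
  \<comment> \<open>By Hermiticity, the conjugate of \<open>X j\<close> in its second index is again
    antisymmetric and orthogonal to \<open>axial_vec u\<close>, so
    \<open>wedge_decomposition\<close> applies a second time.\<close>
  have row: "X j (3 * k + l) = cnj (u k) * R j l - cnj (u l) * R j k" if j: "j < 3" and kl: "k < 3" "l < 3" for j k l
  proof -
    have "(\<Sum>K<9. cnj (axial_vec u K) * cnj (X j K)) = 0"
      using arg_cong[OF Xorth[OF j], of cnj] by simp
    then have "cnj (X j (3 * k + l)) = u k * (\<Sum>m<3. cnj (u m) * cnj (X j (3 * m + l)))
        - u l * (\<Sum>m<3. cnj (u m) * cnj (X j (3 * m + k)))"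
      using Xanti[OF j] kl by (intro wedge_decomposition[OF u, of "\<lambda>K. cnj (X j K)"]) auto
    then have "X j (3 * k + l) = cnj (u k * (\<Sum>m<3. cnj (u m) * cnj (X j (3 * m + l)))
        - u l * (\<Sum>m<3. cnj (u m) * cnj (X j (3 * m + k))))"
      by (metis complex_cnj_cnj)
    then show ?thesis
      using j kl by (simp add: R mult.commute)
  qed
  show ?thesis
  proof
    show "pos_kernel R"
      using pos_kernel_contract[OF K(1), of u] unfolding R_def[abs_def] .
    fix l :: nat assume l: "l < 3"
    \<comment> \<open>Contracting both sides of an antisymmetric tensor with the same vector gives
      zero.\<close>
    have "(\<Sum>j<3. cnj (u j) * X j J) = 0" if J: "J < 9" for J
      using antisym_values[of "\<lambda>I. A $$ (I, J)", OF anti[OF _ J]] arg_cong[OF numeral_2_eq_2, of "\<lambda>I. A $$ (I, J)"]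
      by (simp add: X_def sum_less_three algebra_simps)
    moreover have "(\<Sum>j<3. cnj (u j) * R j l) = (\<Sum>k<3. (\<Sum>j<3. cnj (u j) * X j (3 * k + l)) * u k)"
      using l by (simp add: R sum_less_three algebra_simps)
    ultimately show "(\<Sum>j<3. cnj (u j) * R j l) = 0"
      using l by simp
  next
    fix i j k l :: nat assume ijkl: "i < 3" "j < 3" "k < 3" "l < 3"
    then show "A $$ (3 * i + j, 3 * k + l)
        = u i * (cnj (u k) * R j l - cnj (u l) * R j k) - u j * (cnj (u k) * R i l - cnj (u l) * R i k)"
      by (simp add: col row)
  qed
qed

section \<open>The partially transposed state and the strict Rains bound\<close>

lemma pos_kernel_hermitian: "pos_kernel K \<Longrightarrow> K j i = cnj (K i j)"
  by (induction rule: pos_kernel.induct) auto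

text \<open>The partial transpose of \<open>\<rho>\<close> is \<open>E\<close> minus the cross terms
  of \<open>\<omega>\<close> and \<open>r\<close>, where \<open>E\<close> is positive of trace 1,
  \<open>\<omega>\<close> is a unit vector and \<open>r\<close> is \<open>R\<close> as a vector, of
  norm \<open>s\<close>. Completing the square absorbs the cross terms into \<open>s\<close> times
  the square of \<open>\<omega>\<close> plus \<open>1 / s\<close> times that of \<open>r\<close>;
  this weighting minimises the added trace, which is \<open>2 * s\<close>.\<close>

lemma rains_antisymmetric_rank_two:
  assumes \<rho>: "density_op 9 \<rho>" and rank: "vec_space.rank 9 \<rho> = 2" and u: "unit_vec3 u"
    and anti: "\<And>I J. I < 9 \<Longrightarrow> J < 9 \<Longrightarrow> \<rho> $$ (flip I, J) = - \<rho> $$ (I, J)"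
    and orth: "\<And>J. J < 9 \<Longrightarrow> (\<Sum>K<9. cnj (axial_vec u K) * \<rho> $$ (K, J)) = 0"
  shows "rains 3 3 \<rho> < 1"
proof -
  have psd: "psd 9 \<rho>" and tr\<rho>: "mtrace \<rho> = 1"
    using \<rho> by (auto simp: density_op_def)
  have car: "\<rho> \<in> carrier_mat 9 9"
    using psd by (simp add: psd_def)
  obtain R where R: "pos_kernel R" "\<And>l. l < 3 \<Longrightarrow> (\<Sum>j<3. cnj (u j) * R j l) = 0"
    and ent: "\<And>i j k l. i < 3 \<Longrightarrow> j < 3 \<Longrightarrow> k < 3 \<Longrightarrow> l < 3 \<Longrightarrow> \<rho> $$ (3 * i + j, 3 * k + l)
      = u i * (cnj (u k) * R j l - cnj (u l) * R j k) - u j * (cnj (u k) * R i l - cnj (u l) * R i k)"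
    using wedge_state_decomposition[OF psd u anti orth] by blast
  have ent': "\<rho> $$ (I, J) = u (I div 3) * (cnj (u (J div 3)) * R (I mod 3) (J mod 3) - cnj (u (J mod 3)) * R (I mod 3) (J div 3))
      - u (I mod 3) * (cnj (u (J div 3)) * R (I div 3) (J mod 3) - cnj (u (J mod 3)) * R (I div 3) (J div 3))"
    if "I < 9" "J < 9" for I J
    using ent[of "I div 3" "I mod 3" "J div 3" "J mod 3"] that by (simp add: mult_div_mod_eq)
  define N where "N = u 0 * cnj (u 0) + u 1 * cnj (u 1) + u 2 * cnj (u 2)"
  have N: "N = 1"
    using u by (simp only: N_def)
  \<comment> \<open>The map from x to the wedge of \<open>u\<close> and x doubles squared norms on
    the complement of \<open>u\<close>, so \<open>R\<close> carries half of the trace of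
    \<open>\<rho>\<close>.\<close>
  have trR: "(\<Sum>j<3. R j j) = 1 / 2"
  proof -
    have "1 = (\<Sum>I<9. \<rho> $$ (I, I))"
      using tr\<rho> car by (simp add: mtrace_sum[of _ 9])
    also have "\<dots> = (\<Sum>i<3. \<Sum>j<3. u i * (cnj (u i) * R j j - cnj (u j) * R j i) - u j * (cnj (u i) * R i j - cnj (u j) * R i i))"
      unfolding sum_less_nine by (intro sum.cong refl ent) auto
    also have "\<dots> = 2 * (N * (\<Sum>j<3. R j j)) - 2 * (\<Sum>i<3. u i * (\<Sum>j<3. cnj (u j) * R j i))"
      by (simp add: sum_less_three N_def algebra_simps)
    also have "\<dots> = 2 * (\<Sum>j<3. R j j)"
      using R(2) N by simp
    finally show ?thesis
      by (simp add: eq_divide_eq mult.commute)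
  qed
  define Rm where "Rm = mat 3 3 (\<lambda>(i, j). R i j)"
  have Rm: "psd 3 Rm"
    by (rule psd_of_pos_kernel[OF _ R(1)]) (simp_all add: Rm_def)
  define q where "q = (\<Sum>i<3. \<Sum>j<3. (cmod (R i j))\<^sup>2)"
  \<comment> \<open>Here 1/4 is the squared trace of \<open>R\<close>. Reaching it would make
    \<open>R\<close> of rank one, and then \<open>\<rho>\<close> would be the rank-one operator of
    the wedge of \<open>u\<close> and \<open>y\<close>.\<close>
  have q_lt: "q < 1 / 4"
  proof (rule ccontr)
    assume "\<not> q < 1 / 4"
    moreover have "mtrace Rm = complex_of_real (1 / 2)"
      using trR by (simp add: Rm_def mtrace_def)
    then have "(Re (mtrace Rm))\<^sup>2 = 1 / 4"
      by (simp only: Re_complex_of_real power2_eq_square)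
    moreover have "(\<Sum>i<3. \<Sum>j<3. (cmod (Rm $$ (i, j)))\<^sup>2) = q"
      by (simp add: Rm_def q_def)
    ultimately have "(Re (mtrace Rm))\<^sup>2 \<le> (\<Sum>i<3. \<Sum>j<3. (cmod (Rm $$ (i, j)))\<^sup>2)"
      by linarith
    then obtain y where "\<And>i j. i < 3 \<Longrightarrow> j < 3 \<Longrightarrow> Rm $$ (i, j) = y i * cnj (y j)"
      using psd_rank_one_of_frobenius[OF Rm] by blast
    then have y: "R i j = y i * cnj (y j)" if "i < 3" "j < 3" for i j
      using that by (simp add: Rm_def)
    have "vec_space.rank 9 \<rho> \<le> 1"
    proof (rule vec_space.rank_le_1_product_entries[OF car])
      fix I J assume "I < dim_row \<rho>" "J < dim_col \<rho>"
      then have IJ: "I < 9" "J < 9"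
        using car by auto
      then have lt: "I div 3 < 3" "I mod 3 < 3" "J div 3 < 3" "J mod 3 < 3"
        by auto
      show "\<rho> $$ (I, J) = (u (I div 3) * y (I mod 3) - u (I mod 3) * y (I div 3))
          * cnj (u (J div 3) * y (J mod 3) - u (J mod 3) * y (J div 3))"
        unfolding ent'[OF IJ] using lt by (simp add: y algebra_simps)
    qed
    then show False
      using rank by simp
  qed
  \<comment> \<open>Positivity of \<open>q\<close> is needed for the weight \<open>1 / s\<close> in
    \<open>Z\<close>.\<close>
  have q_pos: "0 < q"
  proof -
    have "q \<noteq> 0"
    proof
      assume "q = 0"
      then have "\<forall>i<3. (\<Sum>j<3. (cmod (R i j))\<^sup>2) = 0"
        unfolding q_def by (subst (asm) sum_nonneg_eq_0_iff) (auto intro: sum_nonneg)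
      then have "R i i = 0" if "i < 3" for i
        using that by (auto simp: sum_nonneg_eq_0_iff)
      then show False
        using trR by simp
    qed
    then show ?thesis
      by (simp add: q_def sum_nonneg less_le)
  qed
  define s where "s = sqrt q"
  have s: "0 < s" "s\<^sup>2 = q" "s < 1 / 2"
    using q_pos q_lt real_sqrt_less_mono[OF q_lt] by (auto simp: s_def real_sqrt_divide)
  let ?s = "complex_of_real s"
  define \<omega> where "\<omega> I = u (I div 3) * cnj (u (I mod 3))" for I
  define r where "r I = R (I div 3) (I mod 3)" for I
  define E where "E I J = (u (I div 3) * cnj (u (J div 3))) * cnj (R (I mod 3) (J mod 3))
    + R (I div 3) (J div 3) * cnj (u (I mod 3) * cnj (u (J mod 3)))" for I J
  define Z where "Z = mat 9 9 (\<lambda>(I, J). E I J + ?s * (\<omega> I * cnj (\<omega> J)) + complex_of_real (1 / s) * (r I * cnj (r J)))"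
  have Zc: "Z \<in> carrier_mat 9 9"
    by (simp add: Z_def)
  have Epos: "pos_kernel E"
    unfolding E_def[abs_def]
    by (rule pos_kernel.add[OF
          pos_kernel_mult[OF pos_kernel.rank_one[of "\<lambda>I. u (I div 3)"] pos_kernel_cnj[OF pos_kernel_comp[OF R(1), of "\<lambda>I. I mod 3"]]]
          pos_kernel_mult[OF pos_kernel_comp[OF R(1), of "\<lambda>I. I div 3"] pos_kernel_cnj[OF pos_kernel.rank_one[of "\<lambda>I. u (I mod 3)"]]]])
  have pt: "partial_transpose 3 3 \<rho> $$ (I, J) = E I J - \<omega> I * cnj (r J) - r I * cnj (\<omega> J)"
    if IJ: "I < 9" "J < 9" for I J
  proof -
    have lt: "I div 3 < 3" "I mod 3 < 3" "J div 3 < 3" "J mod 3 < 3"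
      using IJ by auto
    have "partial_transpose 3 3 \<rho> $$ (I, J) = \<rho> $$ (3 * (I div 3) + J mod 3, 3 * (J div 3) + I mod 3)"
      using IJ by (simp add: index_partial_transpose mult.commute)
    also have "\<dots> = u (I div 3) * (cnj (u (J div 3)) * R (J mod 3) (I mod 3) - cnj (u (I mod 3)) * R (J mod 3) (J div 3))
        - u (J mod 3) * (cnj (u (J div 3)) * R (I div 3) (I mod 3) - cnj (u (I mod 3)) * R (I div 3) (J div 3))"
      by (rule ent[OF lt(1,4,3,2)])
    also have "\<dots> = E I J - \<omega> I * cnj (r J) - r I * cnj (\<omega> J)"
      unfolding E_def \<omega>_def r_def pos_kernel_hermitian[OF R(1), of "J mod 3" "I mod 3"]
        pos_kernel_hermitian[OF R(1), of "J mod 3" "J div 3"]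
      by (simp add: algebra_simps)
    finally show ?thesis .
  qed
  have ptc: "partial_transpose 3 3 \<rho> \<in> carrier_mat 9 9"
    using partial_transpose_carrier[of 3 3 \<rho>] by simp
  have "psd 9 (Z - partial_transpose 3 3 \<rho>)"
  proof (rule psd_of_pos_kernel)
    show "Z - partial_transpose 3 3 \<rho> \<in> carrier_mat 9 9"
      by (rule minus_carrier_mat[OF ptc])
    show "pos_kernel (\<lambda>I J. complex_of_real (1 / s) * ((?s * \<omega> I + r I) * cnj (?s * \<omega> J + r J)))"
      using s(1) by (intro pos_kernel_scale[OF pos_kernel.rank_one[of "\<lambda>I. ?s * \<omega> I + r I"]]) simp
    fix I J :: nat assume IJ: "I < 9" "J < 9"
    then have "(Z - partial_transpose 3 3 \<rho>) $$ (I, J) = Z $$ (I, J) - partial_transpose 3 3 \<rho> $$ (I, J)"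
      using Zc ptc by simp
    also have "\<dots> = complex_of_real (1 / s) * ((?s * \<omega> I + r I) * cnj (?s * \<omega> J + r J))"
      unfolding pt[OF IJ] using IJ s(1) by (simp add: Z_def field_simps)
    finally show "(Z - partial_transpose 3 3 \<rho>) $$ (I, J) = complex_of_real (1 / s) * ((?s * \<omega> I + r I) * cnj (?s * \<omega> J + r J))" .
  qed
  moreover have "psd 9 (Z + partial_transpose 3 3 \<rho>)"
  proof (rule psd_of_pos_kernel)
    show "Z + partial_transpose 3 3 \<rho> \<in> carrier_mat 9 9"
      by (rule add_carrier_mat[OF ptc])
    show "pos_kernel (\<lambda>I J. (E I J + E I J) + complex_of_real (1 / s) * ((?s * \<omega> I - r I) * cnj (?s * \<omega> J - r J)))"
      using s(1) by (intro pos_kernel.add[OF pos_kernel.add[OF Epos Epos] pos_kernel_scale[OF pos_kernel.rank_one[of "\<lambda>I. ?s * \<omega> I - r I"]]]) simp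
    fix I J :: nat assume IJ: "I < 9" "J < 9"
    then have "(Z + partial_transpose 3 3 \<rho>) $$ (I, J) = Z $$ (I, J) + partial_transpose 3 3 \<rho> $$ (I, J)"
      using Zc ptc by simp
    also have "\<dots> = (E I J + E I J) + complex_of_real (1 / s) * ((?s * \<omega> I - r I) * cnj (?s * \<omega> J - r J))"
      unfolding pt[OF IJ] using IJ s(1) by (simp add: Z_def field_simps)
    finally show "(Z + partial_transpose 3 3 \<rho>) $$ (I, J)
        = (E I J + E I J) + complex_of_real (1 / s) * ((?s * \<omega> I - r I) * cnj (?s * \<omega> J - r J))" .
  qed
  \<comment> \<open>The two halves of \<open>E\<close> contribute 1/2 each, the terms of
    \<open>\<omega>\<close> and \<open>r\<close> contribute \<open>s\<close> each.\<close>
  moreover have trZ: "mtrace Z = complex_of_real (1 + 2 * s)"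
  proof -
    have "mtrace Z = (\<Sum>i<3. \<Sum>j<3. u i * cnj (u i) * cnj (R j j) + R i i * cnj (u j * cnj (u j))
        + ?s * (u i * cnj (u j) * cnj (u i * cnj (u j))) + complex_of_real (1 / s) * (R i j * cnj (R i j)))"
      unfolding mtrace_sum[OF Zc] sum_less_nine
      by (intro sum.cong refl) (simp add: Z_def E_def \<omega>_def r_def)
    also have "\<dots> = N * cnj (\<Sum>j<3. R j j) + N * (\<Sum>j<3. R j j) + ?s * (N * N)
        + complex_of_real (1 / s) * (\<Sum>i<3. \<Sum>j<3. R i j * cnj (R i j))"
      by (simp add: sum_less_three N_def algebra_simps)
    also have "(\<Sum>i<3. \<Sum>j<3. R i j * cnj (R i j)) = complex_of_real (s\<^sup>2)"
      unfolding s(2) q_def of_real_sum complex_norm_square ..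
    also have "complex_of_real (1 / s) * complex_of_real (s\<^sup>2) = ?s"
      using s(1) by (simp add: power2_eq_square)
    finally show ?thesis
      unfolding trR N by simp
  qed
  ultimately have "rains 3 3 \<rho> \<le> ereal (log 2 (1 + 2 * s))"
    using rains_le[of 3 3 \<rho> Z] \<rho> Zc s(1) by simp
  also have "\<dots> < 1"
  proof -
    have "log 2 (1 + 2 * s) < log 2 2"
      using s by (subst log_less_cancel_iff) auto
    then show ?thesis
      by (simp add: one_ereal_def)
  qed
  finally show ?thesis .
qed

lemma ppt_rel_ent_tensor_power_ge:
  assumes \<rho>: "density_op 9 \<rho>" and u: "unit_vec3 u"
    and anti: "\<And>I J. I < 9 \<Longrightarrow> J < 9 \<Longrightarrow> \<rho> $$ (flip I, J) = - \<rho> $$ (I, J)"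
    and orth: "\<And>J. J < 9 \<Longrightarrow> (\<Sum>K<9. cnj (axial_vec u K) * \<rho> $$ (K, J)) = 0"
  shows "ereal (real n) \<le> ppt_rel_ent (3 ^ n) (3 ^ n) (tensor_power 3 3 n \<rho>)"
  unfolding ppt_rel_ent_def
proof (rule INF_greatest)
  let ?N = "3 ^ n * 3 ^ n :: nat" and ?P = "wedge_projection u"
  fix \<sigma> assume "\<sigma> \<in> {\<sigma>. density_op ?N \<sigma> \<and> psd ?N (partial_transpose (3 ^ n) (3 ^ n) \<sigma>)}"
  then have \<sigma>: "density_op ?N \<sigma>" "psd ?N (partial_transpose (3 ^ n) (3 ^ n) \<sigma>)"
    by auto
  have car: "\<rho> \<in> carrier_mat 9 9"
    using \<rho> by (simp add: density_op_def psd_def)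
  have "ereal (- log 2 ((1 / 2) ^ n)) \<le> rel_entropy (tensor_power 3 3 n \<rho>) \<sigma>"
  proof (rule rel_entropy_ge_projection[where n = ?N and P = "tensor_power 3 3 n ?P"])
    show "density_op ?N (tensor_power 3 3 n \<rho>)"
      using density_op_tensor_power[of 3 3 \<rho> n] \<rho> by simp
    show "psd ?N \<sigma>"
      using \<sigma>(1) by (simp add: density_op_def)
    show "mat_adjoint (tensor_power 3 3 n ?P) = tensor_power 3 3 n ?P"
      by (subst mat_adjoint_tensor_power) (simp_all add: wedge_projection_adjoint)
    show "tensor_power 3 3 n ?P * tensor_power 3 3 n ?P = tensor_power 3 3 n ?P"
      by (subst tensor_power_mult) (simp_all add: wedge_projection_idem[OF u])
    show "tensor_power 3 3 n ?P * tensor_power 3 3 n \<rho> = tensor_power 3 3 n \<rho>"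
      by (subst tensor_power_mult) (simp_all add: car wedge_projection_fixes[OF car anti orth])
  qed (use wedge_projection_overlap[OF u \<sigma>] in simp_all)
  moreover have "- log 2 ((1 / 2) ^ n) = real n"
    by (simp add: log_nat_power log_divide)
  ultimately show "ereal (real n) \<le> rel_entropy (tensor_power 3 3 n \<rho>) \<sigma>"
    by simp
qed

section \<open>Passage to the regularised quantities\<close>

lemma tensor_power_one:
  assumes "A \<in> carrier_mat (dA * dB) (dA * dB)"
  shows "tensor_power dA dB 1 A = A"
proof (rule eq_matI)
  fix i j assume "i < dim_row A" "j < dim_col A"
  then have ij: "i < dA * dB" "j < dA * dB"
    using assms by auto
  have "copy_index dA dB 1 0 i = i" if "i < dA * dB" for i
    using that by (simp add: copy_index_def digit_def less_mult_imp_div_less)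
  then show "tensor_power dA dB 1 A $$ (i, j) = A $$ (i, j)"
    using ij by (simp add: tensor_power_def)
qed (use assms in \<open>auto simp: tensor_power_def\<close>)

theorem mainTheorem7:
  fixes \<rho> :: "complex mat"
  assumes "density_op (3 * 3) \<rho>"
    and "vec_space.rank (3 * 3) \<rho> = 2"
    and "mat_supp \<rho> \<subseteq> antisym_space 3"
  shows "rains 3 3 \<rho> < ppt_rel_ent_reg 3 3 \<rho> \<and> rains_reg 3 3 \<rho> < ppt_rel_ent_reg 3 3 \<rho>"
proof -
  have \<rho>: "density_op 9 \<rho>" and rank: "vec_space.rank 9 \<rho> = 2"
    using assms(1,2) by simp_all
  have psd: "psd 9 \<rho>" and car: "\<rho> \<in> carrier_mat 9 9"
    using \<rho> by (simp_all add: density_op_def psd_def)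
  note anti = antisym_support_entries[OF car assms(3)]
  obtain u where u: "unit_vec3 u" and orth: "\<And>J. J < 9 \<Longrightarrow> (\<Sum>K<9. cnj (axial_vec u K) * \<rho> $$ (K, J)) = 0"
    using exists_orthogonal_axial[OF psd rank anti] by blast
  have "rains 3 3 \<rho> < 1"
    by (rule rains_antisymmetric_rank_two[OF \<rho> rank u anti orth])
  \<comment> \<open>An infimum preserves only weak inequalities, so the strictness has to come from
    the Rains side.\<close>
  moreover have "1 \<le> ppt_rel_ent_reg 3 3 \<rho>"
    unfolding ppt_rel_ent_reg_def
  proof (rule INF_greatest)
    fix n :: nat assume "n \<in> {1..}"
    then have n: "0 < real n"
      by simp
    have "(1 :: ereal) = ereal (real n) / ereal (real n)"
      using n by (simp add: one_ereal_def)
    also have "\<dots> \<le> ppt_rel_ent (3 ^ n) (3 ^ n) (tensor_power 3 3 n \<rho>) / ereal (real n)"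
      using ppt_rel_ent_tensor_power_ge[OF \<rho> u anti orth] n by (intro ereal_divide_right_mono) auto
    finally show "1 \<le> ppt_rel_ent (3 ^ n) (3 ^ n) (tensor_power 3 3 n \<rho>) / ereal (real n)" .
  qed
  moreover have "rains_reg 3 3 \<rho> \<le> rains 3 3 \<rho>"
  proof -
    have "rains_reg 3 3 \<rho> \<le> rains (3 ^ 1) (3 ^ 1) (tensor_power 3 3 1 \<rho>) / ereal (real 1)"
      unfolding rains_reg_def by (rule INF_lower) simp
    also have "\<dots> = rains 3 3 \<rho>"
      using tensor_power_one[of \<rho> 3 3] car by (simp add: one_ereal_def[symmetric])
    finally show ?thesis .
  qed
  ultimately show ?thesis
    by (meson le_less_trans less_le_trans)
qed

end
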